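(* Let $\mathcal A=\bigoplus_{\alpha=1}^NX_\alpha$ with $X_\alpha=M_{n_\alpha}(\mathbb C)$, and let $\omega=\mathrm{Tr}(\rho\,\cdot\,)$ be a faithful state on $\mathcal A$, where $\rho=\bigoplus_\alpha\rho_\alpha$ with $\rho_\alpha\in X_\alpha$ positive and invertible and $\sum_\alpha\mathrm{Tr}\,\rho_\alpha=1$. Let $(X,m,\iota)$ be the normalized $C^*$-Frobenius algebra in the category of finite-dimensional Hilbert spaces corresponding to $(\mathcal A,\omega)$. Then: (a) $(X,m,\iota)$ is special (a Q-system) if and only if there exists $d>0$ such that $\mathrm{Tr}(\rho_\alpha^{-1})=d$ for all $\alpha$. (b) $(X,m,\iota)$ is standard if and only if $\rho_\alpha=\dfrac{n_\alpha}{\sum_{\beta=1}^Nn_\beta^2}\,1_{X_\alpha}$ for all $\alpha$. (c) The associated crossing symmetric operator $T:=m^*m:X\otimes X\to X\otimes X$ acts on pure tensors by $$x_\alpha\otimes y_\beta\mapsto\delta_{\alpha,\beta}\,(x_\alpha y_\beta\otimes\rho_\beta^{-1})F_\alpha$$ for every $x_\alpha\in X_\alpha$, $y_\beta\in X_\beta$, where $F_\alpha:=\sum_{i,j=1}^{n_\alpha}E^{(\alpha)}_{ij}\otimes E^{(\alpha)}_{ji}\in X_\alpha\otimes X_\alpha$ and $E^{(\alpha)}_{ij}$ are the matrix units of $X_\alpha$.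
   Context: Given a finite-dimensional $C^*$-algebra $\mathcal A$ with faithful state $\omega$, the corresponding normalized $C^*$-Frobenius algebra $(X,m,\iota)$ is: $X=\mathcal A$ as a Hilbert space with (GNS) scalar product $\langle x,y\rangle=\omega(x^\dagger y)$ ($\dagger$ the $*$-operation of $\mathcal A$), $m:X\otimes X\to X$ the multiplication $m(x\otimes y)=xy$, $\iota:\mathbb C\to X$, $\iota(\lambda)=\lambda1_{\mathcal A}$. Here $\mathrm{Tr}$ is the (non-normalized) matrix trace, summed over blocks, and $m^*$ is the Hilbert space adjoint. A product such as $(x\otimes y)F_\alpha$ is the product in the algebra $X_\alpha\otimes X_\alpha\subset\mathcal A\otimes\mathcal A$. $(X,m,\iota)$ is special (equivalently, a Q-system) if $mm^*=d\,1_X$ for some $d>0$. A Q-system is standard if $d$ equals the intrinsic dimension of $X$, which in the category of finite-dimensional Hilbert spaces is the vector space dimension $\dim X=\sum_\alpha n_\alpha^2$. "Crossing symmetric" refers to the identity $(1_{X\otimes X}\otimes\mathrm{ev}_X)(1_X\otimes T\otimes1_X)(\mathrm{coev}_X\otimes1_{X\otimes X})=T^*$ with $\mathrm{ev}_X=\iota^*m$, $\mathrm{coev}_X=m^*\iota$. *)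

theory Defs
  imports
    "Jordan_Normal_Form.Schur_Decomposition"
    "Jordan_Normal_Form.Gauss_Jordan_Elimination"
    "HOL-Library.Function_Algebras"
begin

section \<open>Finite-dimensional Hilbert spaces in coordinates\<close>

text \<open>A finite-dimensional Hilbert space is given by a finite index set of a linear (not
  necessarily orthonormal) basis together with a scalar product, antilinear in its first argument.
  Its vectors are the coordinate functions vanishing outside the index set.\<close>

record 'i hilb =
  ix :: "'i set"
  ip :: "('i \<Rightarrow> complex) \<Rightarrow> ('i \<Rightarrow> complex) \<Rightarrow> complex"

definition vecs :: "('i, 'z) hilb_scheme \<Rightarrow> ('i \<Rightarrow> complex) set" where
  "vecs H = {v. \<forall>i. i \<notin> ix H \<longrightarrow> v i = 0}"

definition scale :: "complex \<Rightarrow> ('i \<Rightarrow> complex) \<Rightarrow> 'i \<Rightarrow> complex" where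
  "scale c v = (\<lambda>i. c * v i)"

definition hdim :: "('i, 'z) hilb_scheme \<Rightarrow> nat" where
  "hdim H = vector_space.dim scale (vecs H)"

definition bvec :: "'i \<Rightarrow> 'i \<Rightarrow> complex" where
  "bvec i = (\<lambda>j. if j = i then 1 else 0)"

definition hunit :: "unit hilb" where
  "hunit = \<lparr>ix = UNIV, ip = (\<lambda>v w. cnj (v ()) * w ())\<rparr>"

definition tens :: "('i \<Rightarrow> complex) \<Rightarrow> ('j \<Rightarrow> complex) \<Rightarrow> 'i \<times> 'j \<Rightarrow> complex" where
  "tens v w = (\<lambda>(i, j). v i * w j)"

text \<open>The scalar product of the tensor product is the sesquilinear extension of
  \<open>\<langle>v \<otimes> w, v' \<otimes> w'\<rangle> = \<langle>v, v'\<rangle> \<langle>w, w'\<rangle>\<close>.\<close>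

definition htensor :: "('i, 'z) hilb_scheme \<Rightarrow> ('j, 'y) hilb_scheme \<Rightarrow> ('i \<times> 'j) hilb" where
  "htensor H K = \<lparr>ix = ix H \<times> ix K,
     ip = (\<lambda>s t. \<Sum>(i, j)\<in>ix H \<times> ix K. \<Sum>(k, l)\<in>ix H \<times> ix K.
        cnj (s (i, j)) * t (k, l) * (ip H (bvec i) (bvec k) * ip K (bvec j) (bvec l)))\<rparr>"

text \<open>The linear map on the tensor product of \<open>H\<close> and \<open>K\<close> induced by a bilinear map \<open>b\<close>,
  i.e. the one sending \<open>v \<otimes> w\<close> to \<open>b v w\<close>.\<close>

definition tlift :: "('i, 'z) hilb_scheme \<Rightarrow> ('j, 'y) hilb_scheme \<Rightarrow>
    (('i \<Rightarrow> complex) \<Rightarrow> ('j \<Rightarrow> complex) \<Rightarrow> 'k \<Rightarrow> complex) \<Rightarrow> ('i \<times> 'j \<Rightarrow> complex) \<Rightarrow> 'k \<Rightarrow> complex" where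
  "tlift H K b t = (\<Sum>(i, j)\<in>ix H \<times> ix K. scale (t (i, j)) (b (bvec i) (bvec j)))"

text \<open>Tensor product \<open>f \<otimes> g\<close> of linear maps, where \<open>H\<close> and \<open>K\<close> are the domains of \<open>f\<close> and \<open>g\<close>.\<close>

definition otensor :: "('i, 'z) hilb_scheme \<Rightarrow> ('j, 'y) hilb_scheme \<Rightarrow>
    (('i \<Rightarrow> complex) \<Rightarrow> 'k \<Rightarrow> complex) \<Rightarrow> (('j \<Rightarrow> complex) \<Rightarrow> 'l \<Rightarrow> complex) \<Rightarrow>
    ('i \<times> 'j \<Rightarrow> complex) \<Rightarrow> 'k \<times> 'l \<Rightarrow> complex" where
  "otensor H K f g = tlift H K (\<lambda>v w. tens (f v) (g w))"

text \<open>Hilbert space adjoint of a linear map \<open>f\<close> from \<open>H\<close> to \<open>K\<close>; meaningful on \<open>vecs K\<close>.\<close>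

definition hadj :: "('i, 'z) hilb_scheme \<Rightarrow> ('j, 'y) hilb_scheme \<Rightarrow>
    (('i \<Rightarrow> complex) \<Rightarrow> 'j \<Rightarrow> complex) \<Rightarrow> ('j \<Rightarrow> complex) \<Rightarrow> 'i \<Rightarrow> complex" where
  "hadj H K f w = (THE u. u \<in> vecs H \<and> (\<forall>v\<in>vecs H. ip H u v = ip K w (f v)))"


section \<open>Algebras in the category of finite-dimensional Hilbert spaces\<close>

record 'i frob = "'i hilb" +
  fmult :: "('i \<times> 'i \<Rightarrow> complex) \<Rightarrow> 'i \<Rightarrow> complex"
  funit :: "(unit \<Rightarrow> complex) \<Rightarrow> 'i \<Rightarrow> complex"

definition fcomult :: "('i, 'z) frob_scheme \<Rightarrow> ('i \<Rightarrow> complex) \<Rightarrow> 'i \<times> 'i \<Rightarrow> complex" where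
  "fcomult X = hadj (htensor X X) X (fmult X)"

definition fcounit :: "('i, 'z) frob_scheme \<Rightarrow> ('i \<Rightarrow> complex) \<Rightarrow> unit \<Rightarrow> complex" where
  "fcounit X = hadj hunit X (funit X)"

definition special_with :: "('i, 'z) frob_scheme \<Rightarrow> real \<Rightarrow> bool" where
  "special_with X d \<longleftrightarrow> d > 0 \<and> (\<forall>x\<in>vecs X. fmult X (fcomult X x) = scale (complex_of_real d) x)"

definition special :: "('i, 'z) frob_scheme \<Rightarrow> bool" where
  "special X \<longleftrightarrow> (\<exists>d. special_with X d)"

definition standard :: "('i, 'z) frob_scheme \<Rightarrow> bool" where
  "standard X \<longleftrightarrow> (\<exists>d. special_with X d \<and> d = real (hdim X))"

definition ev :: "('i, 'z) frob_scheme \<Rightarrow> ('i \<times> 'i \<Rightarrow> complex) \<Rightarrow> unit \<Rightarrow> complex" where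
  "ev X t = fcounit X (fmult X t)"

definition coev :: "('i, 'z) frob_scheme \<Rightarrow> (unit \<Rightarrow> complex) \<Rightarrow> 'i \<times> 'i \<Rightarrow> complex" where
  "coev X z = fcomult X (funit X z)"

text \<open>\<open>(1\<^bsub>X \<otimes> X\<^esub> \<otimes> ev) (1\<^bsub>X\<^esub> \<otimes> T \<otimes> 1\<^bsub>X\<^esub>) (coev \<otimes> 1\<^bsub>X \<otimes> X\<^esub>) = T\<^sup>*\<close>. The four local functions
  are the coherence isomorphisms, in this order:
  \<open>X \<otimes> X \<cong> \<complex> \<otimes> (X \<otimes> X)\<close>,
  \<open>(X \<otimes> X) \<otimes> (X \<otimes> X) \<cong> (X \<otimes> (X \<otimes> X)) \<otimes> X\<close>, its inverse, and
  \<open>(X \<otimes> X) \<otimes> \<complex> \<cong> X \<otimes> X\<close>.\<close>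

definition crossing_symmetric ::
  "('i, 'z) frob_scheme \<Rightarrow> (('i \<times> 'i \<Rightarrow> complex) \<Rightarrow> 'i \<times> 'i \<Rightarrow> complex) \<Rightarrow> bool" where
  "crossing_symmetric X T \<longleftrightarrow>
    (let XX = htensor X X;
         lunit_inv = (\<lambda>t. \<lambda>(u :: unit, p). t p);
         regroup = (\<lambda>s. \<lambda>((a, (b, c)), d). s ((a, b), (c, d)));
         regroup_inv = (\<lambda>s. \<lambda>((a, b), (c, d)). s ((a, (b, c)), d));
         runit = (\<lambda>s. \<lambda>p. s (p, ()))
     in \<forall>t\<in>vecs XX.
          runit (otensor XX XX id (ev X)
            (regroup_inv (otensor (htensor X XX) X (otensor X XX id T) id
              (regroup (otensor hunit XX (coev X) id (lunit_inv t))))))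
          = hadj XX XX T t)"


section \<open>Matrices\<close>

definition mat_trace :: "'a :: comm_monoid_add mat \<Rightarrow> 'a" where
  "mat_trace A = (\<Sum>i<dim_row A. A $$ (i, i))"

text \<open>With the order on \<open>complex\<close>, \<open>0 \<le> z\<close> says that \<open>z\<close> is real and nonnegative.\<close>

definition positive_mat :: "complex mat \<Rightarrow> bool" where
  "positive_mat A \<longleftrightarrow> square_mat A \<and> (\<forall>v\<in>carrier_vec (dim_row A). 0 \<le> (A *\<^sub>v v) \<bullet>c v)"

definition inv_mat :: "complex mat \<Rightarrow> complex mat" where
  "inv_mat A = the (mat_inverse A)"

definition unit_mat :: "nat \<Rightarrow> nat \<Rightarrow> nat \<Rightarrow> complex mat" where
  "unit_mat k i j = mat k k (\<lambda>p. if p = (i, j) then 1 else 0)"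


section \<open>The multi-matrix algebra with block sizes \<open>n 0, \<dots>, n (N - 1)\<close>\<close>

text \<open>An element \<open>x\<close> is given by its matrix entries: \<open>x (\<alpha>, i, j)\<close> is the entry \<open>(i, j)\<close> of
  block \<open>\<alpha>\<close>. Thus \<open>bvec (\<alpha>, i, j)\<close> is a matrix unit. Blocks are numbered from \<open>0\<close>.\<close>

type_synonym elt = "nat \<times> nat \<times> nat \<Rightarrow> complex"

definition entries :: "nat \<Rightarrow> (nat \<Rightarrow> nat) \<Rightarrow> (nat \<times> nat \<times> nat) set" where
  "entries N n = (SIGMA \<alpha>:{..<N}. {..<n \<alpha>} \<times> {..<n \<alpha>})"

definition block :: "(nat \<Rightarrow> nat) \<Rightarrow> elt \<Rightarrow> nat \<Rightarrow> complex mat" where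
  "block n x \<alpha> = mat (n \<alpha>) (n \<alpha>) (\<lambda>(i, j). x (\<alpha>, i, j))"

definition of_blocks :: "nat \<Rightarrow> (nat \<Rightarrow> nat) \<Rightarrow> (nat \<Rightarrow> complex mat) \<Rightarrow> elt" where
  "of_blocks N n M = (\<lambda>(\<alpha>, i, j). if (\<alpha>, i, j) \<in> entries N n then M \<alpha> $$ (i, j) else 0)"

definition embed_block :: "nat \<Rightarrow> (nat \<Rightarrow> nat) \<Rightarrow> nat \<Rightarrow> complex mat \<Rightarrow> elt" where
  "embed_block N n \<alpha> A = of_blocks N n (\<lambda>\<beta>. if \<beta> = \<alpha> then A else 0\<^sub>m (n \<beta>) (n \<beta>))"

definition amult :: "nat \<Rightarrow> (nat \<Rightarrow> nat) \<Rightarrow> elt \<Rightarrow> elt \<Rightarrow> elt" where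
  "amult N n x y = of_blocks N n (\<lambda>\<alpha>. block n x \<alpha> * block n y \<alpha>)"

definition aone :: "nat \<Rightarrow> (nat \<Rightarrow> nat) \<Rightarrow> elt" where
  "aone N n = of_blocks N n (\<lambda>\<alpha>. 1\<^sub>m (n \<alpha>))"

definition astar :: "nat \<Rightarrow> (nat \<Rightarrow> nat) \<Rightarrow> elt \<Rightarrow> elt" where
  "astar N n x = of_blocks N n (\<lambda>\<alpha>. mat_adjoint (block n x \<alpha>))"

definition density_functional :: "nat \<Rightarrow> (nat \<Rightarrow> nat) \<Rightarrow> (nat \<Rightarrow> complex mat) \<Rightarrow> elt \<Rightarrow> complex" where
  "density_functional N n \<rho> x = (\<Sum>\<alpha><N. mat_trace (\<rho> \<alpha> * block n x \<alpha>))"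

definition gns_hilb :: "nat \<Rightarrow> (nat \<Rightarrow> nat) \<Rightarrow> (elt \<Rightarrow> complex) \<Rightarrow> (nat \<times> nat \<times> nat) hilb" where
  "gns_hilb N n \<omega> = \<lparr>ix = entries N n, ip = (\<lambda>x y. \<omega> (amult N n (astar N n x) y))\<rparr>"

definition gns_frobenius :: "nat \<Rightarrow> (nat \<Rightarrow> nat) \<Rightarrow> (elt \<Rightarrow> complex) \<Rightarrow> (nat \<times> nat \<times> nat) frob" where
  "gns_frobenius N n \<omega> =
    \<lparr>ix = ix (gns_hilb N n \<omega>), ip = ip (gns_hilb N n \<omega>),
     fmult = tlift (gns_hilb N n \<omega>) (gns_hilb N n \<omega>) (amult N n),
     funit = (\<lambda>z. scale (z ()) (aone N n))\<rparr>"

text \<open>Multiplication of the tensor square of the algebra: the bilinear extension of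
  \<open>(a \<otimes> b) (c \<otimes> d) = a c \<otimes> b d\<close>.\<close>

definition tmult :: "nat \<Rightarrow> (nat \<Rightarrow> nat) \<Rightarrow> ((nat \<times> nat \<times> nat) \<times> (nat \<times> nat \<times> nat) \<Rightarrow> complex) \<Rightarrow>
    ((nat \<times> nat \<times> nat) \<times> (nat \<times> nat \<times> nat) \<Rightarrow> complex) \<Rightarrow>
    (nat \<times> nat \<times> nat) \<times> (nat \<times> nat \<times> nat) \<Rightarrow> complex" where
  "tmult N n s t = (\<Sum>(a, b)\<in>entries N n \<times> entries N n. \<Sum>(c, d)\<in>entries N n \<times> entries N n.
     scale (s (a, b) * t (c, d))
       (tens (amult N n (bvec a) (bvec c)) (amult N n (bvec b) (bvec d))))"

definition flip_elt :: "nat \<Rightarrow> (nat \<Rightarrow> nat) \<Rightarrow> nat \<Rightarrow>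
    (nat \<times> nat \<times> nat) \<times> (nat \<times> nat \<times> nat) \<Rightarrow> complex" where
  "flip_elt N n \<alpha> = (\<Sum>i<n \<alpha>. \<Sum>j<n \<alpha>.
     tens (embed_block N n \<alpha> (unit_mat (n \<alpha>) i j)) (embed_block N n \<alpha> (unit_mat (n \<alpha>) j i)))"

end

theory Submission
  imports Defs
begin

text \<open>In matrix units everything is explicit. The adjoint of the multiplication is
  \<open>m\<^sup>* w = \<Sum> w E\<^sub>i\<^sub>j \<otimes> \<rho>\<^sub>\<alpha>\<^sup>-\<^sup>1 E\<^sub>j\<^sub>i\<close>, which is the formula for \<open>T\<close>; applying \<open>m\<close> multiplies block \<open>\<alpha>\<close> of
  \<open>w\<close> by \<open>Tr \<rho>\<^sub>\<alpha>\<^sup>-\<^sup>1\<close>. For the standard case put \<open>D = dim X\<close> and \<open>c\<^sub>\<alpha> = n\<^sub>\<alpha> / D\<close>: the numbers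
  \<open>Tr ((\<rho>\<^sub>\<alpha> - c\<^sub>\<alpha>) \<rho>\<^sub>\<alpha>\<^sup>-\<^sup>1 (\<rho>\<^sub>\<alpha> - c\<^sub>\<alpha>)) = Tr \<rho>\<^sub>\<alpha> - n\<^sub>\<alpha>\<^sup>2 / D\<close> are nonnegative and sum to zero, so each of them
  vanishes, which forces \<open>\<rho>\<^sub>\<alpha> = c\<^sub>\<alpha>\<close>. As \<open>T\<close> is self-adjoint, crossing symmetry is the invariance of \<open>T\<close>
  under the rotation, which can be checked on matrix units.\<close>

section \<open>Linear algebra in coordinates\<close>

lemma sum_fun_apply: "(\<Sum>a\<in>A. f a) x = (\<Sum>a\<in>A. f a x)"
  by (induction A rule: infinite_finite_induct) auto

lemma tlift_apply: "tlift H K b t k = (\<Sum>(i, j)\<in>ix H \<times> ix K. t (i, j) * b (bvec i) (bvec j) k)"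
  by (simp add: tlift_def sum_fun_apply scale_def case_prod_beta)

lemma otensor_apply:
  "otensor H K f g t (k, l) = (\<Sum>(i, j)\<in>ix H \<times> ix K. t (i, j) * (f (bvec i) k * g (bvec j) l))"
  by (simp add: otensor_def tlift_apply tens_def)

text \<open>The coordinate of \<open>bvec i\<close> at \<open>k\<close> is a Kronecker delta, so the
  identity leg fixes the first index. For \<open>k\<close> outside \<open>ix H\<close> no summand
  survives, which is why membership is assumed here and the other case is stated separately.\<close>

lemma otensor_id_left:
  assumes "finite (ix H)" "k \<in> ix H"
  shows "otensor H K id g t (k, l) = (\<Sum>j\<in>ix K. t (k, j) * g (bvec j) l)"
proof -
  have "otensor H K id g t (k, l) =
      (\<Sum>i\<in>ix H. if i = k then (\<Sum>j\<in>ix K. t (k, j) * g (bvec j) l) else 0)"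
    unfolding otensor_apply sum.cartesian_product[symmetric]
    by (intro sum.cong refl) (auto simp: bvec_def)
  then show ?thesis
    using assms by simp
qed

lemma otensor_id_right:
  assumes "finite (ix K)" "l \<in> ix K"
  shows "otensor H K f id t (k, l) = (\<Sum>i\<in>ix H. t (i, l) * f (bvec i) k)"
proof -
  have "otensor H K f id t (k, l) =
      (\<Sum>i\<in>ix H. \<Sum>j\<in>ix K. if j = l then t (i, l) * f (bvec i) k else 0)"
    unfolding otensor_apply sum.cartesian_product[symmetric]
    by (intro sum.cong refl) (auto simp: bvec_def)
  then show ?thesis
    using assms by simp
qed

lemma otensor_id_left_outside: "k \<notin> ix H \<Longrightarrow> otensor H K id g t (k, l) = 0"
  unfolding otensor_apply by (rule sum.neutral) (auto simp: bvec_def)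

lemma bvec_commute: "bvec i j = bvec j i"
  by (simp add: bvec_def)

lemma cnj_bvec [simp]: "cnj (bvec i j) = bvec i j"
  by (simp add: bvec_def)

lemma sum_bvec: "finite A \<Longrightarrow> (\<Sum>i\<in>A. f i * bvec j i) = (if j \<in> A then f j else 0)"
  by (simp add: bvec_def if_distrib cong: if_cong)

lemma vecs_outside: "v \<in> vecs H \<Longrightarrow> i \<notin> ix H \<Longrightarrow> v i = 0"
  by (simp add: vecs_def)

lemma bvec_in_vecs: "i \<in> ix H \<Longrightarrow> bvec i \<in> vecs H"
  by (auto simp: vecs_def bvec_def)

lemma vecs_eqI:
  assumes "v \<in> vecs H" "w \<in> vecs H" "\<And>i. i \<in> ix H \<Longrightarrow> v i = w i"
  shows "v = w"
proof
  show "v i = w i" for i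
    using assms by (cases "i \<in> ix H") (auto simp: vecs_def)
qed

text \<open>\<open>hadj\<close> is a definite description and the record \<open>hilb\<close> carries
  no axioms for \<open>ip\<close>, so uniqueness has to be supplied: the third premise is
  nondegeneracy of \<open>ip H\<close> at \<open>u\<close>.\<close>

lemma hadj_eqI:
  assumes "u \<in> vecs H" "\<And>v. v \<in> vecs H \<Longrightarrow> ip H u v = ip K w (f v)"
    and "\<And>u'. u' \<in> vecs H \<Longrightarrow> (\<And>v. v \<in> vecs H \<Longrightarrow> ip H u' v = ip H u v) \<Longrightarrow> u' = u"
  shows "hadj H K f w = u"
  unfolding hadj_def
proof (rule the_equality)
  show "u \<in> vecs H \<and> (\<forall>v\<in>vecs H. ip H u v = ip K w (f v))"
    using assms(1,2) by blast
  show "u' = u" if "u' \<in> vecs H \<and> (\<forall>v\<in>vecs H. ip H u' v = ip K w (f v))" for u'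
    using assms(2,3) that by metis
qed

lemma vector_space_scale: "vector_space scale"
  by unfold_locales (auto simp: scale_def fun_eq_iff algebra_simps)

text \<open>The vectors \<open>bvec i\<close> form a basis: evaluating a vanishing combination at
  \<open>i\<close> isolates one coefficient, and a vector of \<open>vecs H\<close> is the
  combination of them with its own coordinates.\<close>

lemma hdim_eq_card:
  assumes "finite (ix H)"
  shows "hdim H = card (ix H)"
proof -
  interpret vector_space scale
    by (rule vector_space_scale)
  have inj: "inj_on bvec (ix H)"
    by (rule inj_onI) (metis bvec_def zero_neq_one)
  have "independent (bvec ` ix H)"
  proof (rule independent_if_scalars_zero)
    show "finite (bvec ` ix H)"
      using assms by simp
    fix f x
    assume sum0: "(\<Sum>v\<in>bvec ` ix H. scale (f v) v) = 0" and "x \<in> bvec ` ix H"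
    then obtain i where i: "i \<in> ix H" "x = bvec i"
      by auto
    have "0 = (\<Sum>j\<in>ix H. scale (f (bvec j)) (bvec j)) i"
      using sum0 by (simp add: sum.reindex[OF inj])
    also have "\<dots> = f (bvec i)"
      using i assms by (simp add: sum_fun_apply scale_def bvec_def if_distrib cong: if_cong)
    finally show "f x = 0"
      using i by simp
  qed
  moreover have "vecs H \<subseteq> span (bvec ` ix H)"
  proof
    fix v assume v: "v \<in> vecs H"
    have "v = (\<Sum>i\<in>ix H. scale (v i) (bvec i))"
      using v assms
      by (auto simp: fun_eq_iff sum_fun_apply scale_def bvec_def vecs_def if_distrib cong: if_cong)
    also have "\<dots> \<in> span (bvec ` ix H)"
      by (intro span_sum span_scale span_base) auto
    finally show "v \<in> span (bvec ` ix H)" .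
  qed
  ultimately have "dim (vecs H) = card (bvec ` ix H)"
    by (intro dim_unique) (auto intro: bvec_in_vecs)
  then show ?thesis
    by (simp add: hdim_def card_image inj)
qed

section \<open>Positive matrices\<close>

text \<open>The form \<open>(A *\<^sub>v v) \<bullet>c w\<close> of \<open>positive_mat\<close>,
  taken on coordinate functions so that no vector dimensions have to be carried along. It is linear
  in \<open>v\<close> and antilinear in \<open>w\<close>.\<close>

definition sesq :: "complex mat \<Rightarrow> (nat \<Rightarrow> complex) \<Rightarrow> (nat \<Rightarrow> complex) \<Rightarrow> complex" where
  "sesq A v w = (\<Sum>i<dim_row A. \<Sum>j<dim_row A. A $$ (i, j) * v j * cnj (w i))"

lemma sesq_add_left: "sesq A (\<lambda>i. v i + c * v' i) w = sesq A v w + c * sesq A v' w"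
  by (simp add: sesq_def sum.distrib sum_distrib_left algebra_simps)

lemma sesq_add_right: "sesq A v (\<lambda>i. w i + c * w' i) = sesq A v w + cnj c * sesq A v w'"
  by (simp add: sesq_def sum.distrib sum_distrib_left algebra_simps)

lemma sesq_bvec:
  assumes "i < dim_row A" "j < dim_row A"
  shows "sesq A (bvec j) (bvec i) = A $$ (i, j)"
  using assms by (simp add: sesq_def sum_bvec flip: sum_distrib_right)

lemma positive_mat_sesq:
  assumes "positive_mat A"
  shows "0 \<le> sesq A v v"
proof -
  let ?n = "dim_row A"
  have "dim_col A = ?n"
    using assms by (simp add: positive_mat_def)
  moreover have "0 \<le> (A *\<^sub>v vec ?n v) \<bullet>c vec ?n v"
    using assms by (simp add: positive_mat_def)
  ultimately show ?thesis
    by (simp add: sesq_def scalar_prod_def sum_distrib_right atLeast0LessThan)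
qed

text \<open>Polarization: the form is real on e_i + c e_j. Taking c = 1 compares the imaginary parts
  of the two entries, and c equal to the imaginary unit compares the real parts.\<close>

lemma positive_mat_hermitian:
  assumes "positive_mat A" "i < dim_row A" "j < dim_row A"
  shows "cnj (A $$ (i, j)) = A $$ (j, i)"
proof -
  have *: "0 \<le> sesq A (\<lambda>k. bvec i k + c * bvec j k) (\<lambda>k. bvec i k + c * bvec j k)" for c
    by (rule positive_mat_sesq[OF assms(1)])
  have 1: "Im (A $$ (i, i) + c * A $$ (i, j) + cnj c * (A $$ (j, i) + c * A $$ (j, j))) = 0" for c
    using *[of c] assms(2,3)
    by (simp add: sesq_add_left sesq_add_right sesq_bvec less_eq_complex_def algebra_simps)
  have "Im (A $$ (i, i)) = 0" "Im (A $$ (j, j)) = 0"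
    using positive_mat_sesq[OF assms(1), of "bvec i"] positive_mat_sesq[OF assms(1), of "bvec j"]
      assms(2,3) by (simp_all add: sesq_bvec less_eq_complex_def)
  then show ?thesis
    using 1[of 1] 1[of \<i>] by (simp add: complex_eq_iff)
qed

text \<open>A zero of the form minimizes it, so its first variation vanishes. If coordinate
  \<open>i\<close> of \<open>A\<close> applied to \<open>v\<close> were a nonzero \<open>a\<close>,
  moving \<open>v\<close> slightly along e_i would make the form negative.\<close>

lemma positive_mat_null:
  assumes pos: "positive_mat A" and null: "sesq A v v = 0" and i: "i < dim_row A"
  shows "(\<Sum>j<dim_row A. A $$ (i, j) * v j) = 0"
proof -
  define a where "a = (\<Sum>j<dim_row A. A $$ (i, j) * v j)"
  have a: "sesq A v (bvec i) = a"
    using i by (simp add: sesq_def sum_bvec a_def flip: sum_distrib_right)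
  have "sesq A (bvec i) v = cnj a"
  proof -
    have "sesq A (bvec i) v = (\<Sum>k<dim_row A. A $$ (k, i) * cnj (v k))"
      using i by (simp add: sesq_def sum_bvec flip: sum_distrib_right)
    also have "\<dots> = cnj a"
      using positive_mat_hermitian[OF pos i] by (simp add: a_def)
    finally show ?thesis .
  qed
  have aa: "a * cnj a = (of_real (cmod a))\<^sup>2"
    using complex_norm_square[of a] by simp
  define b where "b = Re (A $$ (i, i))"
  have *: "0 \<le> 2 * t * (cmod a)\<^sup>2 + t\<^sup>2 * (cmod a)\<^sup>2 * b" for t :: real
  proof -
    \<comment> \<open>The phase of \<open>a\<close> in the coefficient makes the two cross terms add
      up to the real number 2 t |a|^2.\<close>
    define c where "c = of_real t * a"
    have "0 \<le> Re (sesq A (\<lambda>k. v k + c * bvec i k) (\<lambda>k. v k + c * bvec i k))"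
      using positive_mat_sesq[OF pos] by (simp add: less_eq_complex_def)
    also have "\<dots> = Re (c * cnj a + cnj c * a + (c * cnj c) * A $$ (i, i))"
      using i by (simp add: sesq_add_left sesq_add_right null a \<open>sesq A (bvec i) v = cnj a\<close>
          sesq_bvec algebra_simps)
    also have "c * cnj a + cnj c * a = of_real (2 * t * (cmod a)\<^sup>2)"
      using aa by (simp add: c_def mult_ac)
    also have "c * cnj c = of_real (t\<^sup>2 * (cmod a)\<^sup>2)"
      using aa by (simp add: c_def mult_ac power2_eq_square)
    finally show ?thesis
      by (simp add: b_def)
  qed
  show ?thesis
  proof (rule ccontr)
    assume "\<not> ?thesis"
    then have "(cmod a)\<^sup>2 > 0"
      by (simp add: a_def)
    \<comment> \<open>This \<open>t\<close> is negative with |t b| < 1, so the factor 2 + t b stays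
      positive and the whole expression is negative.\<close>
    moreover define t where "t = - 1 / (1 + \<bar>b\<bar>)"
    have "2 * t * (cmod a)\<^sup>2 + t\<^sup>2 * (cmod a)\<^sup>2 * b = (cmod a)\<^sup>2 * (t * (2 + t * b))"
      by (simp add: algebra_simps power2_eq_square)
    moreover have "2 + t * b > 0"
      by (simp add: t_def field_simps abs_if)
    moreover have "t < 0"
      by (simp add: t_def)
    ultimately show False
      using *[of t] by (simp add: zero_le_mult_iff)
  qed
qed

text \<open>The abstract inverse \<open>B\<close> shows that \<open>A\<close> is a unit of the
  matrix ring, which rules out the result \<open>None\<close> of \<open>mat_inverse\<close>. The
  dimensions of \<open>B\<close> have to be recovered from the two product equations first.\<close>

lemma inv_mat:
  assumes "A \<in> carrier_mat n n" "invertible_mat A"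
  shows "inv_mat A \<in> carrier_mat n n" "A * inv_mat A = 1\<^sub>m n" "inv_mat A * A = 1\<^sub>m n"
proof -
  obtain B where B: "inverts_mat A B" "inverts_mat B A"
    using assms(2) by (auto simp: invertible_mat_def)
  then have "B \<in> carrier_mat n n"
    using assms(1) unfolding inverts_mat_def
    by (metis carrier_matD carrier_matI index_mult_mat(2,3) index_one_mat(2,3))
  then have "A \<in> Units (ring_mat TYPE(complex) n ())"
    using assms(1) B by (auto simp: Units_def ring_mat_def inverts_mat_def)
  then obtain C where C: "mat_inverse A = Some C"
    using mat_inverse(1)[OF assms(1)] by fastforce
  show "inv_mat A \<in> carrier_mat n n" "A * inv_mat A = 1\<^sub>m n" "inv_mat A * A = 1\<^sub>m n"
    using mat_inverse(2)[OF assms(1) C] by (simp_all add: inv_mat_def C)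
qed

lemma mat_mult_index:
  assumes "A \<in> carrier_mat n n" "B \<in> carrier_mat n n" "i < n" "j < n"
  shows "(A * B) $$ (i, j) = (\<Sum>k<n. A $$ (i, k) * B $$ (k, j))"
  using assms by (simp add: scalar_prod_def atLeast0LessThan)

text \<open>\<open>g\<close> is \<open>Tr ((A - c) A\<^sup>-\<^sup>1 (A - c))\<close>; below, \<open>U j\<close> is column \<open>j\<close> of \<open>A\<^sup>-\<^sup>1 (A - c)\<close>.\<close>

lemma trace_gap:
  fixes c :: real
  assumes A: "A \<in> carrier_mat n n" "positive_mat A" "invertible_mat A"
  defines "g \<equiv> mat_trace A - 2 * of_real c * of_nat n + (of_real c)\<^sup>2 * mat_trace (inv_mat A)"
  shows "0 \<le> g" and "g = 0 \<Longrightarrow> A = of_real c \<cdot>\<^sub>m 1\<^sub>m n"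
proof -
  let ?R = "inv_mat A"
  note R = inv_mat[OF A(1,3)]
  define \<delta> :: "nat \<Rightarrow> nat \<Rightarrow> complex" where "\<delta> i j = (if i = j then 1 else 0)" for i j
  have AR: "(\<Sum>k<n. A $$ (i, k) * ?R $$ (k, j)) = \<delta> i j" if "i < n" "j < n" for i j
    using mat_mult_index[OF A(1) R(1) that] R(2) that by (simp add: \<delta>_def)
  have cnj_\<delta>: "cnj (\<delta> i j) = \<delta> i j" for i j
    by (simp add: \<delta>_def)
  have sum_\<delta>: "(\<Sum>k<n. f k * \<delta> k j) = f j" if "j < n" for f j
    using that by (simp add: \<delta>_def if_distrib cong: if_cong)
  define U where "U j i = \<delta> i j - of_real c * ?R $$ (i, j)" for i j
  define q where "q j = sesq A (U j) (U j)" for j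
  have AU: "(\<Sum>k<n. A $$ (i, k) * U j k) = A $$ (i, j) - of_real c * \<delta> i j" if "i < n" "j < n" for i j
    using AR[OF that] sum_\<delta>[OF that(2)]
    by (simp add: U_def right_diff_distrib sum_subtractf mult.left_commute flip: sum_distrib_left)
  have q_pos: "0 \<le> q j" for j
    unfolding q_def by (rule positive_mat_sesq[OF A(2)])
  have q_eq: "q j = A $$ (j, j) - 2 * of_real c + (of_real c)\<^sup>2 * ?R $$ (j, j)" if j: "j < n" for j
  proof -
    have "q j = (\<Sum>i<n. (A $$ (i, j) - of_real c * \<delta> i j) * cnj (U j i))"
      using A(1) j AU by (simp add: q_def sesq_def flip: sum_distrib_right)
    \<comment> \<open>Conjugation moves the bar onto the entries of \<open>A\<close>, where
      hermiticity is known, and brings the sum into the form of \<open>AU\<close>. It is undone at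
      the end because \<open>q j\<close> is real.\<close>
    then have "cnj (q j) = (\<Sum>i<n. (A $$ (j, i) - of_real c * \<delta> i j) * U j i)"
      using A(1) j positive_mat_hermitian[OF A(2)] cnj_\<delta> by simp
    also have "\<dots> = (\<Sum>i<n. A $$ (j, i) * U j i) - of_real c * (\<Sum>i<n. U j i * \<delta> i j)"
      by (simp add: sum_subtractf sum_distrib_left algebra_simps)
    also have "\<dots> = A $$ (j, j) - 2 * of_real c + (of_real c)\<^sup>2 * ?R $$ (j, j)"
      unfolding AU[OF j j] sum_\<delta>[OF j] by (simp add: U_def \<delta>_def algebra_simps power2_eq_square)
    also have "cnj (q j) = q j"
      using q_pos[of j] by (simp add: less_eq_complex_def complex_eq_iff)
    finally show ?thesis .
  qed
  have g: "g = (\<Sum>j<n. q j)"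
    using A(1) R(1)
    by (simp add: g_def q_eq mat_trace_def sum.distrib sum_subtractf sum_distrib_left)
  show "0 \<le> g"
    unfolding g using q_pos by (simp add: sum_nonneg)
  assume "g = 0"
  then have q0: "q j = 0" if "j < n" for j
    using that q_pos by (simp add: g sum_nonneg_eq_0_iff)
  show "A = of_real c \<cdot>\<^sub>m 1\<^sub>m n"
  proof (rule eq_matI)
    fix i j assume "i < dim_row (of_real c \<cdot>\<^sub>m 1\<^sub>m n :: complex mat)"
      "j < dim_col (of_real c \<cdot>\<^sub>m 1\<^sub>m n :: complex mat)"
    then have ij: "i < n" "j < n"
      by auto
    \<comment> \<open>As the form vanishes at \<open>U j\<close>, so does \<open>A\<close> applied
      to \<open>U j\<close>; by \<open>AU\<close> this vector is column \<open>j\<close> of A -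
      c.\<close>
    then have "(\<Sum>k<n. A $$ (i, k) * U j k) = 0"
      using positive_mat_null[OF A(2), of "U j" i] q0[OF ij(2)] A(1) by (simp add: q_def)
    then show "A $$ (i, j) = (of_real c \<cdot>\<^sub>m 1\<^sub>m n) $$ (i, j)"
      using AU[OF ij] ij by (simp add: \<delta>_def)
  qed (use A(1) in auto)
qed

section \<open>The multi-matrix algebra\<close>

lemma mem_entries [simp]: "(\<alpha>, i, j) \<in> entries N n \<longleftrightarrow> \<alpha> < N \<and> i < n \<alpha> \<and> j < n \<alpha>"
  by (auto simp: entries_def)

lemma finite_entries [simp]: "finite (entries N n)"
  by (simp add: entries_def)

lemma card_entries: "card (entries N n) = (\<Sum>\<alpha><N. (n \<alpha>)\<^sup>2)"
  by (simp add: entries_def card_SigmaI card_cartesian_product power2_eq_square)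

lemma sum_entries:
  "(\<Sum>p\<in>entries N n. f p) = (\<Sum>\<alpha><N. \<Sum>i<n \<alpha>. \<Sum>j<n \<alpha>. f (\<alpha>, i, j))"
  by (simp add: entries_def sum.cartesian_product sum.Sigma case_prod_beta)

lemma sum_reindex_support:
  assumes "finite A" "inj_on h B" "h ` B \<subseteq> A" "\<And>a. a \<in> A \<Longrightarrow> a \<notin> h ` B \<Longrightarrow> f a = 0"
  shows "(\<Sum>a\<in>A. f a) = (\<Sum>b\<in>B. f (h b))"
proof -
  have "(\<Sum>a\<in>A. f a) = (\<Sum>a\<in>h ` B. f a)"
    using assms(1,3,4) by (intro sum.mono_neutral_right) auto
  then show ?thesis
    by (simp add: sum.reindex[OF assms(2)])
qed

lemma bvec_pair: "bvec (k, l) (i, j) = bvec k i * bvec l j"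
  by (simp add: bvec_def)

lemma mat_adjoint_index:
  "i < dim_col A \<Longrightarrow> j < dim_row A \<Longrightarrow> mat_adjoint A $$ (i, j) = conjugate (A $$ (j, i))"
  by (simp add: mat_adjoint_def mat_of_rows_def)

lemma dim_mat_adjoint [simp]:
  "dim_row (mat_adjoint A) = dim_col A" "dim_col (mat_adjoint A) = dim_row A"
  by (simp_all add: mat_adjoint_def)

lemma block_of_blocks:
  assumes "\<alpha> < N" "M \<alpha> \<in> carrier_mat (n \<alpha>) (n \<alpha>)"
  shows "block n (of_blocks N n M) \<alpha> = M \<alpha>"
  using assms by (intro eq_matI) (auto simp: block_def of_blocks_def)

lemma amult_apply:
  "amult N n x y (\<alpha>, i, j) =
    (if (\<alpha>, i, j) \<in> entries N n then \<Sum>k<n \<alpha>. x (\<alpha>, i, k) * y (\<alpha>, k, j) else 0)"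
  by (simp add: amult_def of_blocks_def block_def scalar_prod_def atLeast0LessThan)

lemma amult_bvec:
  assumes "(\<alpha>, i, j) \<in> entries N n" "(\<beta>, k, l) \<in> entries N n"
  shows "amult N n (bvec (\<alpha>, i, j)) (bvec (\<beta>, k, l)) =
    (if \<alpha> = \<beta> \<and> j = k then bvec (\<alpha>, i, l) else 0)"
proof
  fix p :: "nat \<times> nat \<times> nat"
  obtain \<gamma> a b where p: "p = (\<gamma>, a, b)"
    by (cases p)
  have "(\<Sum>m<n \<gamma>. bvec (\<alpha>, i, j) (\<gamma>, a, m) * bvec (\<beta>, k, l) (\<gamma>, m, b)) =
      (\<Sum>m<n \<gamma>. bvec \<alpha> \<gamma> * bvec i a * bvec \<beta> \<gamma> * bvec k m * bvec l b * bvec j m)"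
    by (simp add: bvec_pair mult_ac)
  then show "amult N n (bvec (\<alpha>, i, j)) (bvec (\<beta>, k, l)) p =
      (if \<alpha> = \<beta> \<and> j = k then bvec (\<alpha>, i, l) else 0) p"
    using assms by (auto simp: p amult_apply sum_bvec) (auto simp: bvec_def)
qed

text \<open>A product of two matrix units has a nonzero entry (i, j) only for the pairs (i, k) and
  (k, j), so both sums over the basis collapse to one sum over the middle index. This contraction
  serves both \<open>fmult\<close> and \<open>tmult\<close>.\<close>

lemma sum_amult_bvec:
  assumes "(\<alpha>, i, j) \<in> entries N n"
  shows "(\<Sum>p\<in>entries N n. \<Sum>q\<in>entries N n. g p q * amult N n (bvec p) (bvec q) (\<alpha>, i, j)) =
    (\<Sum>k<n \<alpha>. g (\<alpha>, i, k) (\<alpha>, k, j))"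
proof -
  let ?I = "entries N n"
  have "(\<Sum>p\<in>?I. \<Sum>q\<in>?I. g p q * amult N n (bvec p) (bvec q) (\<alpha>, i, j)) =
      (\<Sum>p\<in>?I. \<Sum>q\<in>?I. \<Sum>k<n \<alpha>. g p q * bvec (\<alpha>, i, k) p * bvec (\<alpha>, k, j) q)"
    using assms by (simp add: amult_apply sum_distrib_left bvec_commute[of _ "(\<alpha>, _)"] mult_ac)
  also have "\<dots> = (\<Sum>p\<in>?I. \<Sum>k<n \<alpha>. g p (\<alpha>, k, j) * bvec (\<alpha>, i, k) p)"
    using assms by (subst sum.swap) (simp add: sum_bvec)
  also have "\<dots> = (\<Sum>k<n \<alpha>. g (\<alpha>, i, k) (\<alpha>, k, j))"
    using assms by (subst sum.swap) (simp add: sum_bvec)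
  finally show ?thesis .
qed

text \<open>The two legs are multiplied independently. The swaps put the indices \<open>p\<close>,
  \<open>p'\<close> of the first leg inside those of the second, so that
  \<open>sum_amult_bvec\<close> contracts one leg after the other.\<close>

lemma tmult_apply:
  "tmult N n s t ((\<alpha>, a, b), (\<beta>, c, d)) =
    (if (\<alpha>, a, b) \<in> entries N n \<and> (\<beta>, c, d) \<in> entries N n
     then \<Sum>j<n \<beta>. \<Sum>i<n \<alpha>. s ((\<alpha>, a, i), (\<beta>, c, j)) * t ((\<alpha>, i, b), (\<beta>, j, d)) else 0)"
proof -
  let ?I = "entries N n" and ?m = "\<lambda>p q. amult N n (bvec p) (bvec q)"
  have "tmult N n s t ((\<alpha>, a, b), (\<beta>, c, d)) =
      (\<Sum>p\<in>?I. \<Sum>q\<in>?I. \<Sum>p'\<in>?I. \<Sum>q'\<in>?I.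
        s (p, q) * t (p', q') * (?m p p' (\<alpha>, a, b) * ?m q q' (\<beta>, c, d)))"
    by (simp add: tmult_def sum.cartesian_product' sum_fun_apply scale_def tens_def)
  also have "\<dots> = (\<Sum>q\<in>?I. \<Sum>p\<in>?I. \<Sum>p'\<in>?I. \<Sum>q'\<in>?I.
        s (p, q) * t (p', q') * (?m p p' (\<alpha>, a, b) * ?m q q' (\<beta>, c, d)))"
    by (rule sum.swap)
  also have "\<dots> = (\<Sum>q\<in>?I. \<Sum>p\<in>?I. \<Sum>q'\<in>?I. \<Sum>p'\<in>?I.
        s (p, q) * t (p', q') * (?m p p' (\<alpha>, a, b) * ?m q q' (\<beta>, c, d)))"
    by (rule sum.cong[OF refl], rule sum.cong[OF refl], rule sum.swap)
  also have "\<dots> = (\<Sum>q\<in>?I. \<Sum>q'\<in>?I. \<Sum>p\<in>?I. \<Sum>p'\<in>?I.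
        s (p, q) * t (p', q') * (?m p p' (\<alpha>, a, b) * ?m q q' (\<beta>, c, d)))"
    by (rule sum.cong[OF refl], rule sum.swap)
  also have "\<dots> = (\<Sum>q\<in>?I. \<Sum>q'\<in>?I. (\<Sum>p\<in>?I. \<Sum>p'\<in>?I.
        s (p, q) * t (p', q') * ?m p p' (\<alpha>, a, b)) * ?m q q' (\<beta>, c, d))"
    by (simp add: sum_distrib_right mult.assoc)
  also have "\<dots> = (if (\<alpha>, a, b) \<in> ?I \<and> (\<beta>, c, d) \<in> ?I
     then \<Sum>j<n \<beta>. \<Sum>i<n \<alpha>. s ((\<alpha>, a, i), (\<beta>, c, j)) * t ((\<alpha>, i, b), (\<beta>, j, d)) else 0)"
  proof (cases "(\<alpha>, a, b) \<in> ?I \<and> (\<beta>, c, d) \<in> ?I")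
    case True
    then have 1: "(\<Sum>p\<in>?I. \<Sum>p'\<in>?I. s (p, q) * t (p', q') * ?m p p' (\<alpha>, a, b)) =
        (\<Sum>i<n \<alpha>. s ((\<alpha>, a, i), q) * t ((\<alpha>, i, b), q'))" for q q'
      by (intro sum_amult_bvec) auto
    show ?thesis
      unfolding 1 using True by (subst sum_amult_bvec) auto
  next
    case False
    then have "?m p p' (\<alpha>, a, b) = 0 \<or> ?m q q' (\<beta>, c, d) = 0" for p p' q q'
      by (auto simp: amult_apply)
    then have "(\<Sum>p\<in>?I. \<Sum>p'\<in>?I. s (p, q) * t (p', q') * ?m p p' (\<alpha>, a, b)) * ?m q q' (\<beta>, c, d) = 0"
      for q q'
      by (metis (no_types, lifting) mult_zero_left mult_zero_right sum.neutral)
    then show ?thesis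
      by (simp only: False if_False sum.neutral_const)
  qed
  finally show ?thesis .
qed

lemma embed_block_apply:
  "embed_block N n \<alpha> A (\<beta>, i, j) = (if (\<beta>, i, j) \<in> entries N n \<and> \<beta> = \<alpha> then A $$ (i, j) else 0)"
  by (auto simp: embed_block_def of_blocks_def)

lemma amult_embed_block:
  assumes "x \<in> carrier_mat (n \<alpha>) (n \<alpha>)" "y \<in> carrier_mat (n \<beta>) (n \<beta>)"
  shows "amult N n (embed_block N n \<alpha> x) (embed_block N n \<beta> y) =
    (if \<alpha> = \<beta> then embed_block N n \<alpha> (x * y) else 0)"
  using assms
  by (auto simp: fun_eq_iff amult_apply embed_block_apply scalar_prod_def atLeast0LessThan)

lemma flip_elt_apply:
  "flip_elt N n \<alpha> ((\<gamma>, a, b), (\<delta>, c, d)) =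
    (if (\<gamma>, a, b) \<in> entries N n \<and> (\<delta>, c, d) \<in> entries N n \<and> \<gamma> = \<alpha> \<and> \<delta> = \<alpha> \<and> a = d \<and> b = c
     then 1 else 0)"
proof -
  let ?C = "(\<gamma>, a, b) \<in> entries N n \<and> (\<delta>, c, d) \<in> entries N n \<and> \<gamma> = \<alpha> \<and> \<delta> = \<alpha>"
  have e: "embed_block N n \<alpha> (unit_mat (n \<alpha>) i j) (\<beta>, k, l) =
      (if (\<beta>, k, l) \<in> entries N n \<and> \<beta> = \<alpha> then bvec k i * bvec l j else 0)" for i j \<beta> k l
    by (auto simp: embed_block_apply unit_mat_def bvec_def)
  have "flip_elt N n \<alpha> ((\<gamma>, a, b), (\<delta>, c, d)) =
      (\<Sum>i<n \<alpha>. \<Sum>j<n \<alpha>. if ?C then bvec d i * bvec c j * bvec b j * bvec a i else 0)"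
    unfolding flip_elt_def sum_fun_apply tens_def prod.case e by (intro sum.cong refl) auto
  also have "\<dots> = (if ?C \<and> a = d \<and> b = c then 1 else 0)"
  proof (cases ?C)
    case True
    then show ?thesis
      by (auto simp: sum_bvec simp flip: sum_distrib_right) (auto simp: bvec_def)
  next
    case False
    then show ?thesis
      by (simp only: False if_False sum.neutral_const) auto
  qed
  finally show ?thesis
    by simp
qed

section \<open>The Frobenius algebra of a faithful state\<close>

locale multimatrix_state =
  fixes N :: nat and n :: "nat \<Rightarrow> nat" and \<rho> :: "nat \<Rightarrow> complex mat"
  assumes size: "\<And>\<alpha>. \<alpha> < N \<Longrightarrow> n \<alpha> \<ge> 1"
    and carrier: "\<And>\<alpha>. \<alpha> < N \<Longrightarrow> \<rho> \<alpha> \<in> carrier_mat (n \<alpha>) (n \<alpha>)"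
    and pos: "\<And>\<alpha>. \<alpha> < N \<Longrightarrow> positive_mat (\<rho> \<alpha>)"
    and inv: "\<And>\<alpha>. \<alpha> < N \<Longrightarrow> invertible_mat (\<rho> \<alpha>)"
    and norm: "(\<Sum>\<alpha><N. mat_trace (\<rho> \<alpha>)) = 1"
begin

abbreviation "I \<equiv> entries N n"
abbreviation "X \<equiv> gns_frobenius N n (density_functional N n \<rho>)"
abbreviation "XX \<equiv> htensor X X"
abbreviation "r \<alpha> \<equiv> inv_mat (\<rho> \<alpha>)"

lemma r_carrier: "\<alpha> < N \<Longrightarrow> r \<alpha> \<in> carrier_mat (n \<alpha>) (n \<alpha>)"
  by (intro inv_mat carrier inv)

lemma r_mult_\<rho>:
  assumes "\<alpha> < N" "i < n \<alpha>" "j < n \<alpha>"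
  shows "(\<Sum>k<n \<alpha>. r \<alpha> $$ (i, k) * \<rho> \<alpha> $$ (k, j)) = (if i = j then 1 else 0)"
  using mat_mult_index[OF r_carrier carrier, of \<alpha> i j] inv_mat(3)[OF carrier inv, of \<alpha>] assms
  by simp

lemma \<rho>_mult_r:
  assumes "\<alpha> < N" "i < n \<alpha>" "j < n \<alpha>"
  shows "(\<Sum>k<n \<alpha>. \<rho> \<alpha> $$ (i, k) * r \<alpha> $$ (k, j)) = (if i = j then 1 else 0)"
  using mat_mult_index[OF carrier r_carrier, of \<alpha> i j] inv_mat(2)[OF carrier inv, of \<alpha>] assms
  by simp

lemma \<rho>_hermitian:
  assumes "\<alpha> < N" "i < n \<alpha>" "j < n \<alpha>"
  shows "cnj (\<rho> \<alpha> $$ (i, j)) = \<rho> \<alpha> $$ (j, i)"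
  using carrier[OF assms(1)] assms by (intro positive_mat_hermitian pos) auto

section \<open>The scalar product of X and its Gram matrix\<close>

lemma ix_X [simp]: "ix X = I" and ix_XX [simp]: "ix XX = I \<times> I"
  by (simp_all add: gns_frobenius_def gns_hilb_def htensor_def)

text \<open>Coordinates of the linear functional \<open>ip X x\<close>.\<close>

definition dual :: "elt \<Rightarrow> elt" where
  "dual x = (\<lambda>(\<alpha>, k, i). \<Sum>j<n \<alpha>. \<rho> \<alpha> $$ (i, j) * cnj (x (\<alpha>, k, j)))"

lemma ip_X: "ip X x y = (\<Sum>p\<in>I. dual x p * y p)"
proof -
  have "ip X x y = (\<Sum>\<alpha><N. \<Sum>i<n \<alpha>. \<Sum>j<n \<alpha>. \<rho> \<alpha> $$ (i, j) * (\<Sum>k<n \<alpha>. cnj (x (\<alpha>, k, j)) * y (\<alpha>, k, i)))"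
  proof -
    have "mat_trace (\<rho> \<alpha> * block n (amult N n (astar N n x) y) \<alpha>) =
        (\<Sum>i<n \<alpha>. \<Sum>j<n \<alpha>. \<rho> \<alpha> $$ (i, j) * (\<Sum>k<n \<alpha>. cnj (x (\<alpha>, k, j)) * y (\<alpha>, k, i)))"
      if \<alpha>: "\<alpha> < N" for \<alpha>
    proof -
      have star: "block n (astar N n x) \<alpha> = mat_adjoint (block n x \<alpha>)"
        unfolding astar_def using \<alpha> by (intro block_of_blocks carrier_matI) (simp_all add: block_def)
      have "block n (amult N n (astar N n x) y) \<alpha> = block n (astar N n x) \<alpha> * block n y \<alpha>"
        unfolding amult_def using \<alpha> by (intro block_of_blocks) (auto simp: block_def)
      then show ?thesis
        using carrier[OF \<alpha>] unfolding star
        by (simp add: mat_trace_def block_def scalar_prod_def mat_adjoint_index atLeast0LessThan)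
    qed
    then show ?thesis
      by (simp add: gns_frobenius_def gns_hilb_def density_functional_def)
  qed
  \<comment> \<open>The two swaps bring the indices (k, i) of the entry of \<open>y\<close> outside
    in this order; the sum over \<open>j\<close> left inside is \<open>dual x\<close>.\<close>
  also have "\<dots> = (\<Sum>\<alpha><N. \<Sum>i<n \<alpha>. \<Sum>k<n \<alpha>. \<Sum>j<n \<alpha>. \<rho> \<alpha> $$ (i, j) * (cnj (x (\<alpha>, k, j)) * y (\<alpha>, k, i)))"
    unfolding sum_distrib_left by (rule sum.cong[OF refl], rule sum.cong[OF refl], rule sum.swap)
  also have "\<dots> = (\<Sum>\<alpha><N. \<Sum>k<n \<alpha>. \<Sum>i<n \<alpha>. \<Sum>j<n \<alpha>. \<rho> \<alpha> $$ (i, j) * (cnj (x (\<alpha>, k, j)) * y (\<alpha>, k, i)))"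
    by (rule sum.cong[OF refl], rule sum.swap)
  also have "\<dots> = (\<Sum>p\<in>I. dual x p * y p)"
    by (simp add: sum_entries dual_def sum_distrib_right mult.assoc)
  finally show ?thesis .
qed

text \<open>By \<open>ip_X_bvec\<close> below, this is the Gram matrix of the matrix units: a
  Kronecker delta in the block and row indices and \<rho> in the column indices.\<close>

lemma dual_bvec:
  assumes "(\<alpha>, k, j) \<in> I"
  shows "dual (bvec (\<alpha>, k, j)) (\<beta>, l, i) = (if \<alpha> = \<beta> \<and> k = l then \<rho> \<alpha> $$ (i, j) else 0)"
proof -
  have "dual (bvec (\<alpha>, k, j)) (\<beta>, l, i) = bvec \<alpha> \<beta> * bvec k l * (\<Sum>m<n \<beta>. \<rho> \<beta> $$ (i, m) * bvec j m)"
    by (simp add: dual_def bvec_pair sum_distrib_left mult_ac)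
  then show ?thesis
    using assms by (simp add: sum_bvec) (auto simp: bvec_def)
qed

lemma sum_dual_bvec:
  assumes "(\<alpha>, k, i) \<in> I"
  shows "(\<Sum>p\<in>I. g p * dual (bvec p) (\<alpha>, k, i)) = (\<Sum>j<n \<alpha>. g (\<alpha>, k, j) * \<rho> \<alpha> $$ (i, j))"
proof -
  have "(\<Sum>p\<in>I. g p * dual (bvec p) (\<alpha>, k, i)) =
      (\<Sum>j<n \<alpha>. g (\<alpha>, k, j) * dual (bvec (\<alpha>, k, j)) (\<alpha>, k, i))"
    by (rule sum_reindex_support) (use assms in \<open>auto simp: inj_on_def dual_bvec image_iff split: if_splits\<close>)
  then show ?thesis
    using assms by (simp add: dual_bvec)
qed

lemma dual_sum: "p \<in> I \<Longrightarrow> dual x p = (\<Sum>q\<in>I. cnj (x q) * dual (bvec q) p)"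
  by (cases p) (simp add: sum_dual_bvec, simp add: dual_def mult.commute)

text \<open>Multiplying by the inverse of \<rho> inverts the Gram matrix, so the functional
  determines the coordinates of \<open>x\<close> in the index set. This is the nondegeneracy of the
  scalar product.\<close>

lemma r_dual:
  assumes "(\<alpha>, k, j) \<in> I"
  shows "(\<Sum>i<n \<alpha>. r \<alpha> $$ (j, i) * dual x (\<alpha>, k, i)) = cnj (x (\<alpha>, k, j))"
proof -
  have "(\<Sum>i<n \<alpha>. r \<alpha> $$ (j, i) * dual x (\<alpha>, k, i)) =
      (\<Sum>i<n \<alpha>. \<Sum>m<n \<alpha>. r \<alpha> $$ (j, i) * \<rho> \<alpha> $$ (i, m) * cnj (x (\<alpha>, k, m)))"
    by (simp add: dual_def sum_distrib_left mult.assoc)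
  also have "\<dots> = (\<Sum>m<n \<alpha>. (\<Sum>i<n \<alpha>. r \<alpha> $$ (j, i) * \<rho> \<alpha> $$ (i, m)) * cnj (x (\<alpha>, k, m)))"
    by (subst sum.swap) (simp add: sum_distrib_right)
  also have "\<dots> = cnj (x (\<alpha>, k, j))"
    using assms by (simp add: r_mult_\<rho> if_distrib if_distribR cong: if_cong)
  finally show ?thesis .
qed

lemma dual_bvec_hermitian:
  "p \<in> I \<Longrightarrow> q \<in> I \<Longrightarrow> cnj (dual (bvec p) q) = dual (bvec q) p"
  by (cases p, cases q) (auto simp: dual_bvec \<rho>_hermitian)

lemma ip_X_sum: "ip X x y = (\<Sum>p\<in>I. \<Sum>q\<in>I. cnj (x q) * y p * dual (bvec q) p)"
  unfolding ip_X
proof (rule sum.cong[OF refl])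
  fix p assume p: "p \<in> I"
  show "dual x p * y p = (\<Sum>q\<in>I. cnj (x q) * y p * dual (bvec q) p)"
    unfolding dual_sum[OF p, of x] by (simp add: sum_distrib_left mult_ac)
qed

lemma ip_X_zero: "ip X x 0 = 0"
  by (simp add: ip_X)

lemma ip_X_cnj: "cnj (ip X x y) = ip X y x"
  unfolding ip_X_sum by (subst sum.swap) (simp add: dual_bvec_hermitian mult_ac)

lemma ip_X_bvec: "p \<in> I \<Longrightarrow> ip X x (bvec p) = dual x p"
  by (simp add: ip_X sum_bvec)

section \<open>The scalar product of the tensor square\<close>

definition dual2 :: "((nat \<times> nat \<times> nat) \<times> (nat \<times> nat \<times> nat) \<Rightarrow> complex) \<Rightarrow>
    (nat \<times> nat \<times> nat) \<times> (nat \<times> nat \<times> nat) \<Rightarrow> complex" where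
  "dual2 s = (\<lambda>(k, l). \<Sum>i\<in>I. \<Sum>j\<in>I. cnj (s (i, j)) * (dual (bvec i) k * dual (bvec j) l))"

lemma ip_XX_sum:
  "ip XX s t = (\<Sum>i\<in>I. \<Sum>j\<in>I. \<Sum>k\<in>I. \<Sum>l\<in>I.
    cnj (s (i, j)) * t (k, l) * (dual (bvec i) k * dual (bvec j) l))"
proof -
  have "ip XX s t = (\<Sum>i\<in>I. \<Sum>j\<in>I. \<Sum>k\<in>I. \<Sum>l\<in>I.
      cnj (s (i, j)) * t (k, l) * (ip X (bvec i) (bvec k) * ip X (bvec j) (bvec l)))"
    by (simp add: htensor_def sum.cartesian_product')
  then show ?thesis
    by (simp add: ip_X_bvec)
qed

lemma sum_swap4:
  "(\<Sum>i\<in>A. \<Sum>j\<in>B. \<Sum>k\<in>C. \<Sum>l\<in>D. f i j k l) = (\<Sum>k\<in>C. \<Sum>l\<in>D. \<Sum>i\<in>A. \<Sum>j\<in>B. f i j k l)"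
  using sum.swap[of "\<lambda>p q. f (fst p) (snd p) (fst q) (snd q)" "C \<times> D" "A \<times> B"]
  by (simp add: sum.cartesian_product')

text \<open>It identifies \<open>dual2 s\<close> as the coordinates of the functional
  \<open>ip XX s\<close>, as \<open>dual\<close> does for X.\<close>

lemma ip_XX: "ip XX s t = (\<Sum>k\<in>I. \<Sum>l\<in>I. dual2 s (k, l) * t (k, l))"
  unfolding ip_XX_sum by (subst sum_swap4) (simp add: dual2_def sum_distrib_left mult_ac)

lemma ip_XX_cnj: "cnj (ip XX s t) = ip XX t s"
  unfolding ip_XX_sum
  by (subst sum_swap4) (simp add: dual_bvec_hermitian mult_ac)

lemma ip_XX_bvec: "k \<in> I \<Longrightarrow> l \<in> I \<Longrightarrow> ip XX s (bvec (k, l)) = dual2 s (k, l)"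
  by (simp add: ip_XX bvec_pair sum_bvec flip: mult.assoc)

lemma dual2_apply:
  assumes "(\<alpha>, a, b) \<in> I" "(\<beta>, c, d) \<in> I"
  shows "dual2 s ((\<alpha>, a, b), (\<beta>, c, d)) = (\<Sum>d'<n \<beta>.
    (\<Sum>b'<n \<alpha>. cnj (s ((\<alpha>, a, b'), (\<beta>, c, d'))) * \<rho> \<alpha> $$ (b, b')) * \<rho> \<beta> $$ (d, d'))"
proof -
  have "dual2 s ((\<alpha>, a, b), (\<beta>, c, d)) = (\<Sum>j\<in>I. (\<Sum>i\<in>I. cnj (s (i, j)) * dual (bvec i) (\<alpha>, a, b)) *
      dual (bvec j) (\<beta>, c, d))"
    unfolding dual2_def prod.case by (subst sum.swap) (simp add: sum_distrib_right mult.assoc)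
  then show ?thesis
    using assms by (simp only: sum_dual_bvec)
qed

text \<open>Nondegeneracy of the tensor product form, obtained one leg at a time:
  \<open>inner\<close> writes \<open>dual2\<close> as an iterated \<open>dual\<close>, with a
  conjugation in between because \<open>dual\<close> is antilinear, and \<open>dual_inj\<close> is
  applied to each leg.\<close>

lemma dual2_inject:
  assumes eq: "\<And>k l. k \<in> I \<Longrightarrow> l \<in> I \<Longrightarrow> dual2 s (k, l) = dual2 t (k, l)"
    and "p \<in> I" "q \<in> I"
  shows "s (p, q) = t (p, q)"
proof -
  have inner: "dual (\<lambda>k. cnj (dual (\<lambda>l. s (k, l)) q)) p = dual2 s (p, q)" if "p \<in> I" "q \<in> I" for s p q
  proof -
    have "dual (\<lambda>k. cnj (dual (\<lambda>l. s (k, l)) q)) p = (\<Sum>k\<in>I. dual (\<lambda>l. s (k, l)) q * dual (bvec k) p)"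
      by (subst dual_sum[OF that(1)]) simp
    also have "\<dots> = (\<Sum>k\<in>I. (\<Sum>l\<in>I. cnj (s (k, l)) * dual (bvec l) q) * dual (bvec k) p)"
      by (subst dual_sum[OF that(2)]) simp
    finally show ?thesis
      by (simp add: dual2_def sum_distrib_left mult_ac)
  qed
  have dual_inj: "x p = y p" if "\<And>p. p \<in> I \<Longrightarrow> dual x p = dual y p" "p \<in> I" for x y p
  proof -
    obtain \<alpha> k j where p: "p = (\<alpha>, k, j)"
      by (cases p)
    have "cnj (x p) = cnj (y p)"
      using that r_dual[of \<alpha> k j x] r_dual[of \<alpha> k j y] by (simp add: p)
    then show ?thesis
      by simp
  qed
  have "cnj (dual (\<lambda>l. s (p, l)) q') = cnj (dual (\<lambda>l. t (p, l)) q')" if "q' \<in> I" for q'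
    by (rule dual_inj[where x = "\<lambda>k. cnj (dual (\<lambda>l. s (k, l)) q')" and y = "\<lambda>k. cnj (dual (\<lambda>l. t (k, l)) q')"])
      (use that assms in \<open>simp_all add: inner\<close>)
  then show ?thesis
    using dual_inj[of "\<lambda>l. s (p, l)" "\<lambda>l. t (p, l)" q] assms(3) by simp
qed

section \<open>The multiplication and its adjoint\<close>

lemma fmult_sum: "fmult X t p = (\<Sum>k\<in>I. \<Sum>l\<in>I. t (k, l) * amult N n (bvec k) (bvec l) p)"
  by (simp add: gns_frobenius_def tlift_apply gns_hilb_def sum.cartesian_product')

lemma fmult_apply:
  "fmult X t (\<alpha>, i, j) = (if (\<alpha>, i, j) \<in> I then \<Sum>k<n \<alpha>. t ((\<alpha>, i, k), (\<alpha>, k, j)) else 0)"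
proof (cases "(\<alpha>, i, j) \<in> I")
  case True
  then show ?thesis
    by (simp only: fmult_sum sum_amult_bvec if_True)
next
  case False
  then have "amult N n x y (\<alpha>, i, j) = 0" for x y
    by (simp only: amult_apply if_False)
  then show ?thesis
    using False by (simp only: fmult_sum mult_zero_right sum.neutral_const if_False)
qed

lemma fmult_tens: "fmult X (tens x y) = amult N n x y"
  by (auto simp: fun_eq_iff fmult_apply amult_apply tens_def)

lemma fmult_bvec: "fmult X (bvec (p, q)) = amult N n (bvec p) (bvec q)"
proof -
  have "bvec (p, q) = tens (bvec p) (bvec q)"
    by (rule ext) (simp add: tens_def bvec_pair split: prod.split)
  then show ?thesis
    by (simp add: fmult_tens)
qed

text \<open>The coordinates of \<open>(w \<otimes> \<rho>\<^sup>-\<^sup>1) F\<close>.\<close>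

definition comul :: "elt \<Rightarrow> (nat \<times> nat \<times> nat) \<times> (nat \<times> nat \<times> nat) \<Rightarrow> complex" where
  "comul w = (\<lambda>((\<alpha>, a, b), (\<beta>, c, d)). if (\<alpha>, a, b) \<in> I \<and> (\<beta>, c, d) \<in> I \<and> \<alpha> = \<beta>
    then w (\<alpha>, a, d) * r \<alpha> $$ (c, b) else 0)"

lemma comul_in_vecs: "comul w \<in> vecs XX"
  by (auto simp: vecs_def comul_def)

text \<open>The adjoint relation on pairs of matrix units. The inverse of \<rho> in
  \<open>comul w\<close> cancels the Gram matrix of the first leg and leaves the condition
  \<open>b = c\<close> of the product rule for matrix units; the Gram matrix of the second leg turns
  \<open>w\<close> into \<open>dual w\<close>.\<close>

lemma dual2_comul:
  assumes "p \<in> I" "q \<in> I"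
  shows "dual2 (comul w) (p, q) = ip X w (amult N n (bvec p) (bvec q))"
proof -
  obtain \<alpha> a b \<beta> c d where pq: "p = (\<alpha>, a, b)" "q = (\<beta>, c, d)"
    by (cases p, cases q)
  have r\<rho>: "(\<Sum>k<n \<alpha>. cnj (r \<alpha> $$ (c, k)) * \<rho> \<alpha> $$ (b, k)) = (if c = b then 1 else 0)" if "c < n \<alpha>"
  proof -
    have "(\<Sum>k<n \<alpha>. cnj (r \<alpha> $$ (c, k)) * \<rho> \<alpha> $$ (b, k)) =
        cnj (\<Sum>k<n \<alpha>. r \<alpha> $$ (c, k) * \<rho> \<alpha> $$ (k, b))"
      using assms by (simp add: pq \<rho>_hermitian)
    also have "\<dots> = (if c = b then 1 else 0)"
      using assms that by (simp only: pq r_mult_\<rho> mem_entries) simp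
    finally show ?thesis .
  qed
  show ?thesis
  proof (cases "\<alpha> = \<beta>")
    case True
    have "dual2 (comul w) (p, q) = (\<Sum>d'<n \<beta>.
        cnj (w (\<alpha>, a, d')) * (\<Sum>b'<n \<alpha>. cnj (r \<alpha> $$ (c, b')) * \<rho> \<alpha> $$ (b, b')) * \<rho> \<beta> $$ (d, d'))"
      using assms True by (simp add: pq dual2_apply comul_def sum_distrib_left mult.assoc)
    also have "\<dots> = (if b = c then dual w (\<alpha>, a, d) else 0)"
      using assms r\<rho> unfolding True by (simp add: pq) (simp add: dual_def mult_ac)
    also have "\<dots> = ip X w (amult N n (bvec p) (bvec q))"
      using assms True by (simp add: pq amult_bvec ip_X_bvec ip_X_zero)
    finally show ?thesis .
  next
    case False
    then show ?thesis
      using assms by (simp add: pq amult_bvec dual2_apply comul_def ip_X_zero)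
  qed
qed

text \<open>Linear extension of \<open>dual2_comul\<close>: both sides are linear in
  \<open>v\<close> and read only its coordinates in \<open>I \<times> I\<close>.\<close>

lemma ip_comul: "ip XX (comul w) v = ip X w (fmult X v)"
proof -
  have "ip X w (fmult X v) = (\<Sum>p\<in>I. \<Sum>k\<in>I. \<Sum>l\<in>I. dual w p * (v (k, l) * amult N n (bvec k) (bvec l) p))"
    by (simp add: ip_X fmult_sum sum_distrib_left)
  also have "\<dots> = (\<Sum>k\<in>I. \<Sum>l\<in>I. \<Sum>p\<in>I. dual w p * (v (k, l) * amult N n (bvec k) (bvec l) p))"
    by (subst sum.swap, rule sum.cong[OF refl], rule sum.swap)
  also have "\<dots> = (\<Sum>k\<in>I. \<Sum>l\<in>I. ip X w (amult N n (bvec k) (bvec l)) * v (k, l))"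
    by (simp add: ip_X sum_distrib_left mult_ac)
  also have "\<dots> = ip XX (comul w) v"
    by (simp add: ip_XX dual2_comul)
  finally show ?thesis ..
qed

text \<open>Testing two candidates against the basis vectors gives equal values of
  \<open>dual2\<close>, so \<open>dual2_inject\<close> yields the uniqueness that
  \<open>hadj_eqI\<close> asks for.\<close>

lemma hadj_into_XX:
  assumes "u \<in> vecs XX" "\<And>v. v \<in> vecs XX \<Longrightarrow> ip XX u v = ip K w (f v)"
  shows "hadj XX K f w = u"
  using assms
proof (rule hadj_eqI)
  fix u' assume u': "u' \<in> vecs XX" "\<And>v. v \<in> vecs XX \<Longrightarrow> ip XX u' v = ip XX u v"
  have "dual2 u' (k, l) = dual2 u (k, l)" if "k \<in> I" "l \<in> I" for k l
    using u'(2)[of "bvec (k, l)"] that by (simp add: ip_XX_bvec bvec_in_vecs)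
  then show "u' = u"
    using u'(1) assms(1) by (intro vecs_eqI[of _ XX]) (auto intro: dual2_inject)
qed

lemma fcomult_eq: "fcomult X = comul"
  unfolding fcomult_def by (intro ext hadj_into_XX comul_in_vecs ip_comul)

lemma ip_X_scale: "ip X x (scale c y) = c * ip X x y"
  by (simp add: ip_X scale_def sum_distrib_left mult_ac)

lemma funit_eq: "funit X z = scale (z ()) (aone N n)"
  by (simp add: gns_frobenius_def)

text \<open>Pairing with the unit of the algebra gives the state, so the counit is \<omega>
  itself.\<close>

lemma fcounit_eq: "fcounit X w = (\<lambda>_. ip X (aone N n) w)"
  unfolding fcounit_def
proof (rule hadj_eqI)
  show "ip hunit (\<lambda>_. ip X (aone N n) w) v = ip X w (funit X v)" for v
    by (simp add: hunit_def ip_X_cnj funit_eq ip_X_scale)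
  fix u' assume *: "\<And>v. v \<in> vecs hunit \<Longrightarrow> ip hunit u' v = ip hunit (\<lambda>_. ip X (aone N n) w) v"
  have "cnj (u' ()) = cnj (ip X (aone N n) w)"
    using *[of "\<lambda>_. 1"] by (simp add: hunit_def vecs_def)
  then show "u' = (\<lambda>_. ip X (aone N n) w)"
    by (simp add: fun_eq_iff)
qed (simp add: vecs_def hunit_def)

section \<open>Specialness and standardness\<close>

lemma special_with_iff: "special_with X d \<longleftrightarrow> d > 0 \<and> (\<forall>\<alpha><N. mat_trace (r \<alpha>) = of_real d)"
proof -
  have "(\<forall>x\<in>vecs X. fmult X (comul x) = scale (of_real d) x) \<longleftrightarrow> (\<forall>\<alpha><N. mat_trace (r \<alpha>) = of_real d)"
  proof
    \<comment> \<open>On the pair ((i, k), (k, j)) \<open>comul x\<close> equals the entry (i, j) of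
      \<open>x\<close> times the diagonal entry \<open>k\<close> of the inverse, so the sum over
      \<open>k\<close> is a trace.\<close>
    have trace: "fmult X (comul x) (\<alpha>, i, j) = mat_trace (r \<alpha>) * x (\<alpha>, i, j)" if "(\<alpha>, i, j) \<in> I" for x \<alpha> i j
      using that r_carrier[of \<alpha>]
      by (simp add: fmult_apply comul_def mat_trace_def sum_distrib_left mult.commute)
    show "\<forall>\<alpha><N. mat_trace (r \<alpha>) = of_real d" if sp: "\<forall>x\<in>vecs X. fmult X (comul x) = scale (of_real d) x"
    proof (intro allI impI)
      fix \<alpha> assume "\<alpha> < N"
      \<comment> \<open>Every block has size at least 1, so this matrix unit exists; evaluating the
        special equation on it reads off the scalar of the block.\<close>
      then have mem: "(\<alpha>, 0, 0) \<in> I"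
        using size by fastforce
      have "fmult X (comul (bvec (\<alpha>, 0, 0))) (\<alpha>, 0, 0) = of_real d"
        using sp mem by (simp add: bvec_in_vecs scale_def) (simp add: bvec_def)
      then show "mat_trace (r \<alpha>) = of_real d"
        using trace[OF mem, of "bvec (\<alpha>, 0, 0)"] by (simp add: bvec_def)
    qed
    show "\<forall>x\<in>vecs X. fmult X (comul x) = scale (of_real d) x" if tr: "\<forall>\<alpha><N. mat_trace (r \<alpha>) = of_real d"
    proof (intro ballI ext)
      fix x and p :: "nat \<times> nat \<times> nat"
      assume x: "x \<in> vecs X"
      obtain \<alpha> i j where p: "p = (\<alpha>, i, j)"
        by (cases p)
      show "fmult X (comul x) p = scale (of_real d) x p"
      proof (cases "p \<in> I")
        case True
        then show ?thesis
          using trace[of \<alpha> i j x] tr by (simp add: p scale_def)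
      next
        case False
        then have "x p = 0"
          using vecs_outside[OF x] by simp
        then show ?thesis
          using False by (simp only: p fmult_apply scale_def if_False mult_zero_right)
      qed
    qed
  qed
  then show ?thesis
    by (simp add: special_with_def fcomult_eq)
qed

lemma hdim_X: "hdim X = (\<Sum>\<alpha><N. (n \<alpha>)\<^sup>2)"
  by (simp add: hdim_eq_card card_entries)

lemma N_pos: "N > 0"
  using norm by (cases N) auto

text \<open>It makes the dimension an admissible \<open>d\<close> in \<open>special_with\<close> and
  allows division by it.\<close>

lemma hdim_X_pos: "hdim X > 0"
proof -
  have "0 < (n 0)\<^sup>2"
    using size[OF N_pos] by simp
  also have "\<dots> \<le> (\<Sum>\<alpha><N. (n \<alpha>)\<^sup>2)"
    using N_pos by (intro member_le_sum) auto
  finally show ?thesis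
    by (simp add: hdim_X)
qed

lemma standard_iff:
  "standard X \<longleftrightarrow> (\<forall>\<alpha><N. \<rho> \<alpha> = (of_nat (n \<alpha>) / of_nat (\<Sum>\<beta><N. (n \<beta>)\<^sup>2)) \<cdot>\<^sub>m 1\<^sub>m (n \<alpha>))"
  (is "_ \<longleftrightarrow> ?R")
proof -
  define D where "D = real (hdim X)"
  have D: "D > 0"
    using hdim_X_pos by (simp add: D_def)
  define c where "c \<alpha> = real (n \<alpha>) / D" for \<alpha>
  have c: "of_nat (n \<alpha>) / of_nat (\<Sum>\<beta><N. (n \<beta>)\<^sup>2) = complex_of_real (c \<alpha>)" for \<alpha>
    by (simp add: c_def D_def hdim_X)
  have "standard X \<longleftrightarrow> (\<forall>\<alpha><N. mat_trace (r \<alpha>) = of_real D)"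
    using D by (simp add: standard_def special_with_iff D_def)
  also have "\<dots> \<longleftrightarrow> (\<forall>\<alpha><N. \<rho> \<alpha> = of_real (c \<alpha>) \<cdot>\<^sub>m 1\<^sub>m (n \<alpha>))"
  proof
    assume tr: "\<forall>\<alpha><N. mat_trace (r \<alpha>) = of_real D"
    define g where "g \<alpha> = mat_trace (\<rho> \<alpha>) - 2 * of_real (c \<alpha>) * of_nat (n \<alpha>)
      + (of_real (c \<alpha>))\<^sup>2 * mat_trace (r \<alpha>)" for \<alpha>
    have g_pos: "0 \<le> g \<alpha>" if "\<alpha> < N" for \<alpha>
      unfolding g_def by (rule trace_gap(1)[OF carrier pos inv]) (use that in auto)
    \<comment> \<open>With c = n / D and trace D of the inverse, the middle term is -2 n^2 / D and
      the last one is n^2 / D.\<close>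
    have "g \<alpha> = mat_trace (\<rho> \<alpha>) - of_real (real ((n \<alpha>)\<^sup>2) / D)" if "\<alpha> < N" for \<alpha>
      using that tr D by (simp add: g_def c_def power2_eq_square field_simps)
    then have "(\<Sum>\<alpha><N. g \<alpha>) = 1 - of_real ((\<Sum>\<alpha><N. real ((n \<alpha>)\<^sup>2)) / D)"
      by (simp add: sum_subtractf norm sum_divide_distrib)
    also have "(\<Sum>\<alpha><N. real ((n \<alpha>)\<^sup>2)) = D"
      by (simp add: D_def hdim_X)
    also have "1 - complex_of_real (D / D) = 0"
      using D by simp
    finally have "(\<Sum>\<alpha><N. g \<alpha>) = 0" .
    then have "g \<alpha> = 0" if "\<alpha> < N" for \<alpha>
      using g_pos that by (subst (asm) sum_nonneg_eq_0_iff) auto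
    then show "\<forall>\<alpha><N. \<rho> \<alpha> = of_real (c \<alpha>) \<cdot>\<^sub>m 1\<^sub>m (n \<alpha>)"
      using trace_gap(2)[OF carrier pos inv] by (simp add: g_def)
  next
    assume \<rho>: "\<forall>\<alpha><N. \<rho> \<alpha> = of_real (c \<alpha>) \<cdot>\<^sub>m 1\<^sub>m (n \<alpha>)"
    show "\<forall>\<alpha><N. mat_trace (r \<alpha>) = of_real D"
    proof (intro allI impI)
      fix \<alpha> assume \<alpha>: "\<alpha> < N"
      \<comment> \<open>The diagonal of \<rho> times its inverse gives D / n for each diagonal entry
        of the inverse, and \<open>n \<alpha>\<close> of these add up to D.\<close>
      have "r \<alpha> $$ (i, i) = of_real (D / real (n \<alpha>))" if i: "i < n \<alpha>" for i
      proof -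
        have "(\<Sum>k<n \<alpha>. \<rho> \<alpha> $$ (i, k) * r \<alpha> $$ (k, i)) =
            (\<Sum>k<n \<alpha>. if k = i then of_real (c \<alpha>) * r \<alpha> $$ (i, i) else 0)"
          using \<rho> \<alpha> i by (intro sum.cong refl) auto
        then have "of_real (c \<alpha>) * r \<alpha> $$ (i, i) = 1"
          using \<rho>_mult_r[OF \<alpha> i i] i by simp
        then show ?thesis
          using D i by (simp add: c_def field_simps)
      qed
      then show "mat_trace (r \<alpha>) = of_real D"
        using r_carrier[OF \<alpha>] size[OF \<alpha>] by (simp add: mat_trace_def)
    qed
  qed
  finally show ?thesis
    by (simp only: c)
qed

section \<open>The formula for T on pure tensors\<close>

lemma comul_tmult:
  assumes \<alpha>: "\<alpha> < N"
  shows "comul (embed_block N n \<alpha> z) =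
    tmult N n (tens (embed_block N n \<alpha> z) (embed_block N n \<alpha> (r \<alpha>))) (flip_elt N n \<alpha>)"
proof
  fix s :: "(nat \<times> nat \<times> nat) \<times> (nat \<times> nat \<times> nat)"
  obtain \<gamma> a b \<delta> c d where s: "s = ((\<gamma>, a, b), (\<delta>, c, d))"
    by (metis prod.exhaust)
  let ?C = "(\<gamma>, a, b) \<in> I \<and> (\<delta>, c, d) \<in> I"
  show "comul (embed_block N n \<alpha> z) s =
      tmult N n (tens (embed_block N n \<alpha> z) (embed_block N n \<alpha> (r \<alpha>))) (flip_elt N n \<alpha>) s"
  proof (cases "?C \<and> \<gamma> = \<alpha> \<and> \<delta> = \<alpha>")
    case True
    \<comment> \<open>Right multiplication by the flip element exchanges the column indices of the
      two legs: only \<open>i = d\<close> and \<open>j = b\<close> contribute.\<close>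
    then have "(\<Sum>j<n \<delta>. \<Sum>i<n \<gamma>. tens (embed_block N n \<alpha> z) (embed_block N n \<alpha> (r \<alpha>)) ((\<gamma>, a, i), (\<delta>, c, j)) *
        flip_elt N n \<alpha> ((\<gamma>, i, b), (\<delta>, j, d))) =
        (\<Sum>j<n \<alpha>. \<Sum>i<n \<alpha>. z $$ (a, i) * r \<alpha> $$ (c, j) * bvec b j * bvec d i)"
      by (intro sum.cong) (auto simp: tens_def embed_block_apply flip_elt_apply bvec_def)
    also have "\<dots> = z $$ (a, d) * r \<alpha> $$ (c, b)"
      using True by (auto simp: sum_bvec)
    finally show ?thesis
      using True by (simp add: s comul_def embed_block_apply tmult_apply)
  next
    case False
    then show ?thesis
      by (auto simp: s comul_def embed_block_apply tmult_apply tens_def flip_elt_apply)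
  qed
qed

lemma comul_zero: "comul 0 = 0"
  by (auto simp: comul_def fun_eq_iff)

lemma fcomult_fmult_tens:
  assumes "\<alpha> < N" "x \<in> carrier_mat (n \<alpha>) (n \<alpha>)" "y \<in> carrier_mat (n \<beta>) (n \<beta>)"
  shows "fcomult X (fmult X (tens (embed_block N n \<alpha> x) (embed_block N n \<beta> y))) =
    (if \<alpha> = \<beta> then tmult N n (tens (embed_block N n \<alpha> (x * y)) (embed_block N n \<beta> (r \<beta>))) (flip_elt N n \<alpha>)
     else 0)"
  using assms by (simp add: fcomult_eq fmult_tens amult_embed_block comul_zero comul_tmult)

section \<open>Crossing symmetry\<close>

definition T :: "((nat \<times> nat \<times> nat) \<times> (nat \<times> nat \<times> nat) \<Rightarrow> complex) \<Rightarrow>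
    (nat \<times> nat \<times> nat) \<times> (nat \<times> nat \<times> nat) \<Rightarrow> complex" where
  "T t = fcomult X (fmult X t)"

text \<open>Both pairings equal the scalar product of m t with m v. For the second one
  \<open>ip_comul\<close> is read through conjugation, since it has the comultiplication on the
  left.\<close>

lemma hadj_T: "hadj XX XX T t = T t"
proof (rule hadj_into_XX)
  show "T t \<in> vecs XX"
    by (simp add: T_def fcomult_eq comul_in_vecs)
  show "ip XX (T t) v = ip XX t (T v)" for v
    using ip_XX_cnj[of "T v" t]
    by (simp add: T_def fcomult_eq ip_comul ip_X_cnj)
qed

text \<open>The product of the two units is zero or a unit E_il, and the trace of \<rho> E_il is the
  entry (l, i) of \<rho>.\<close>

lemma ev_bvec:
  assumes "(\<alpha>, i, j) \<in> I" "(\<beta>, k, l) \<in> I"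
  shows "ev X (bvec ((\<alpha>, i, j), (\<beta>, k, l))) () = (if \<alpha> = \<beta> \<and> j = k then \<rho> \<alpha> $$ (l, i) else 0)"
proof -
  have "ip X (aone N n) (bvec (\<alpha>, i, l)) = \<rho> \<alpha> $$ (l, i)" if "(\<alpha>, i, l) \<in> I"
  proof -
    have "(\<Sum>m<n \<alpha>. \<rho> \<alpha> $$ (l, m) * cnj (aone N n (\<alpha>, i, m))) =
        (\<Sum>m<n \<alpha>. \<rho> \<alpha> $$ (l, m) * bvec i m)"
      using that by (intro sum.cong refl) (auto simp: aone_def of_blocks_def bvec_def)
    then show ?thesis
      using that by (simp add: ip_X_bvec dual_def sum_bvec)
  qed
  then show ?thesis
    using assms by (auto simp: ev_def fcounit_eq fmult_bvec amult_bvec ip_X_zero)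
qed

lemma coev_apply:
  "coev X (bvec ()) ((\<alpha>, a, b), (\<beta>, c, d)) =
    (if (\<alpha>, a, b) \<in> I \<and> (\<beta>, c, d) \<in> I \<and> \<alpha> = \<beta> \<and> a = d then r \<alpha> $$ (c, b) else 0)"
  by (auto simp: coev_def fcomult_eq funit_eq comul_def scale_def aone_def of_blocks_def bvec_def)

lemma T_bvec:
  assumes "(\<gamma>, k, l) \<in> I" "(\<delta>, c, d) \<in> I"
  shows "T (bvec ((\<gamma>, k, l), (\<delta>, c, d))) ((\<alpha>, a, b), (\<beta>, s, u)) =
    (if (\<alpha>, a, b) \<in> I \<and> (\<beta>, s, u) \<in> I \<and> \<alpha> = \<beta> \<and> \<alpha> = \<gamma> \<and> \<gamma> = \<delta> \<and> l = c \<and> k = a \<and> d = u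
     then r \<alpha> $$ (s, b) else 0)"
  using assms by (auto simp: T_def fcomult_eq fmult_bvec amult_bvec comul_def) (auto simp: bvec_def)

lemma T_sum: "T t s = (\<Sum>k\<in>I. \<Sum>l\<in>I. t (k, l) * T (bvec (k, l)) s)"
proof -
  obtain \<alpha> a b \<beta> c d where s: "s = ((\<alpha>, a, b), (\<beta>, c, d))"
    by (metis prod.exhaust)
  show ?thesis
  proof (cases "(\<alpha>, a, b) \<in> I \<and> (\<beta>, c, d) \<in> I \<and> \<alpha> = \<beta>")
    case True
    then show ?thesis
      unfolding s T_def fcomult_eq comul_def fmult_bvec
      by (auto simp: fmult_sum sum_distrib_right mult.assoc)
  next
    case False
    then show ?thesis
      unfolding s T_def fcomult_eq comul_def prod.case by (simp only: if_False mult_zero_right sum.neutral_const)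
  qed
qed

text \<open>The matrix entries of the rotated \<open>T\<close>, after the identity legs have been contracted.\<close>

lemma crossing_kernel:
  assumes "a \<in> I" "b' \<in> I" "c \<in> I" "d \<in> I"
  shows "(\<Sum>b\<in>I. coev X (bvec ()) (a, b) * (\<Sum>c'\<in>I. T (bvec (b, c)) (b', c') * ev X (bvec (c', d)) ())) =
    T (bvec (c, d)) (a, b')"
proof -
  obtain \<alpha> a1 a2 \<beta> b1 b2 \<gamma> c1 c2 \<delta> d1 d2
    where eqs: "a = (\<alpha>, a1, a2)" "b' = (\<beta>, b1, b2)" "c = (\<gamma>, c1, c2)" "d = (\<delta>, d1, d2)"
    by (metis prod.exhaust)
  let ?C = "\<beta> = \<gamma> \<and> \<gamma> = \<delta> \<and> c2 = d1 \<and> b2 = d2"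
  \<comment> \<open>Summing over \<open>c'\<close> multiplies the \<rho> coming from
    \<open>ev\<close> with the inverse coming from \<open>T\<close>; the result is the delta
    \<open>b2 = d2\<close>. A single \<open>b\<close> survives, and \<open>coev\<close> at it
    supplies the inverse that appears in \<open>T\<close> on the right.\<close>
  have inner: "(\<Sum>c'\<in>I. T (bvec (b, c)) (b', c') * ev X (bvec (c', d)) ()) =
      (if ?C \<and> b = (\<gamma>, b1, c1) then 1 else 0)" if "b \<in> I" for b
  proof -
    obtain \<epsilon> k l where b: "b = (\<epsilon>, k, l)"
      by (cases b)
    have "(\<Sum>c'\<in>I. T (bvec (b, c)) (b', c') * ev X (bvec (c', d)) ()) =
        (\<Sum>s<n \<gamma>. T (bvec (b, c)) (b', (\<gamma>, s, c2)) * ev X (bvec ((\<gamma>, s, c2), d)) ())"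
      by (rule sum_reindex_support)
        (use assms that in \<open>auto simp: inj_on_def eqs b T_bvec image_iff split: if_splits\<close>)
    also have "\<dots> = (\<Sum>s<n \<gamma>. if \<beta> = \<gamma> \<and> \<gamma> = \<delta> \<and> c2 = d1 \<and> b = (\<gamma>, b1, c1)
        then \<rho> \<gamma> $$ (d2, s) * r \<gamma> $$ (s, b2) else 0)"
      using assms that by (intro sum.cong refl) (auto simp: eqs b T_bvec ev_bvec)
    also have "\<dots> = (if ?C \<and> b = (\<gamma>, b1, c1) then 1 else 0)"
    proof (cases "\<beta> = \<gamma> \<and> \<gamma> = \<delta> \<and> c2 = d1 \<and> b = (\<gamma>, b1, c1)")
      case True
      then show ?thesis
        using assms \<rho>_mult_r[of \<gamma> d2 b2] by (auto simp: eqs)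
    next
      case False
      then show ?thesis
        by (simp only: if_False sum.neutral_const) auto
    qed
    finally show ?thesis .
  qed
  have "(\<Sum>b\<in>I. coev X (bvec ()) (a, b) * (\<Sum>c'\<in>I. T (bvec (b, c)) (b', c') * ev X (bvec (c', d)) ())) =
      (\<Sum>b\<in>I. (if ?C then coev X (bvec ()) (a, b) else 0) * bvec (\<gamma>, b1, c1) b)"
    by (rule sum.cong[OF refl]) (auto simp: inner bvec_def[of "(\<gamma>, b1, c1)"])
  also have "\<dots> = (if ?C \<and> (\<gamma>, b1, c1) \<in> I then coev X (bvec ()) (a, (\<gamma>, b1, c1)) else 0)"
    by (subst sum_bvec) auto
  also have "\<dots> = T (bvec (c, d)) (a, b')"
    using assms by (auto simp: eqs coev_apply T_bvec)
  finally show ?thesis .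
qed

lemma crossing_symmetric_T: "crossing_symmetric X T"
  unfolding crossing_symmetric_def Let_def
proof (intro ballI ext)
  fix t and s :: "(nat \<times> nat \<times> nat) \<times> (nat \<times> nat \<times> nat)"
  obtain a b' where s: "s = (a, b')"
    by (cases s)
  \<comment> \<open>\<open>s1\<close> is the tensor after the coevaluation and \<open>s2\<close> the
    one after \<open>T\<close> has acted on the middle legs.\<close>
  define s1 where "s1 = otensor hunit XX (coev X) id (\<lambda>(u :: unit, p). t p)"
  define s2 where "s2 = otensor (htensor X XX) X (otensor X XX id T) id
      ((\<lambda>((a, (b, c)), d). s1 ((a, b), (c, d))))"
  have s1: "s1 (p, (c, d)) = coev X (bvec ()) p * t (c, d)" if "c \<in> I" "d \<in> I" for p c d
    unfolding s1_def using that by (subst otensor_id_right) (auto simp: hunit_def UNIV_unit)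
  have s2: "s2 ((a, (b', c')), d) = (\<Sum>b\<in>I. \<Sum>c\<in>I. coev X (bvec ()) (a, b) * t (c, d) * T (bvec (b, c)) (b', c'))"
    if "a \<in> I" "d \<in> I" for a b' c' d
  proof -
    have ix: "ix (htensor X XX) = I \<times> (I \<times> I)"
      by (simp add: htensor_def)
    \<comment> \<open>The identity on the first leg survives as a delta, which later removes the sum
      over \<open>a'\<close>.\<close>
    have T': "otensor X XX id T (bvec (a', (b, c))) (a, (b', c')) = T (bvec (b, c)) (b', c') * bvec a a'"
      if "b \<in> I" "c \<in> I" for a' b c
    proof -
      have "otensor X XX id T (bvec (a', (b, c))) (a, (b', c')) =
          (\<Sum>p\<in>I \<times> I. bvec a a' * T (bvec p) (b', c') * bvec (b, c) p)"
        using \<open>a \<in> I\<close>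
        by (subst otensor_id_left)
            (simp_all add: bvec_pair[of a' "(b, c)" a] bvec_commute[of a'] mult_ac)
      also have "\<dots> = T (bvec (b, c)) (b', c') * bvec a a'"
        using that by (simp add: sum_bvec)
      finally show ?thesis .
    qed
    have "s2 ((a, (b', c')), d) = (\<Sum>a'\<in>I. \<Sum>b\<in>I. \<Sum>c\<in>I.
        s1 ((a', b), (c, d)) * otensor X XX id T (bvec (a', (b, c))) (a, (b', c')))"
      unfolding s2_def using that by (subst otensor_id_right) (simp_all add: ix sum.cartesian_product')
    also have "\<dots> = (\<Sum>a'\<in>I. (\<Sum>b\<in>I. \<Sum>c\<in>I.
        coev X (bvec ()) (a', b) * t (c, d) * T (bvec (b, c)) (b', c')) * bvec a a')"
      using that by (simp add: s1 T' sum_distrib_right mult.assoc)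
    also have "\<dots> = (\<Sum>b\<in>I. \<Sum>c\<in>I. coev X (bvec ()) (a, b) * t (c, d) * T (bvec (b, c)) (b', c'))"
      using that by (simp add: sum_bvec)
    finally show ?thesis .
  qed
  let ?lhs = "otensor XX XX id (ev X) (\<lambda>((a, b), (c, d)). s2 ((a, (b, c)), d)) (s, ())"
  have "?lhs = T t s"
  proof (cases "a \<in> I \<and> b' \<in> I")
    case True
    have "?lhs = (\<Sum>c'\<in>I. \<Sum>d\<in>I. s2 ((a, (b', c')), d) * ev X (bvec (c', d)) ())"
      using True by (subst otensor_id_left) (simp_all add: s sum.cartesian_product')
    also have "\<dots> = (\<Sum>c'\<in>I. \<Sum>d\<in>I. \<Sum>b\<in>I. \<Sum>c\<in>I.
        t (c, d) * (coev X (bvec ()) (a, b) * (T (bvec (b, c)) (b', c') * ev X (bvec (c', d)) ())))"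
      using True by (simp add: s2 sum_distrib_right sum_distrib_left mult_ac)
    \<comment> \<open>The reordering moves \<open>b\<close> and \<open>c'\<close> innermost, where
      \<open>crossing_kernel\<close> contracts them for fixed \<open>c\<close> and
      \<open>d\<close>.\<close>
    also have "\<dots> = (\<Sum>d\<in>I. \<Sum>c'\<in>I. \<Sum>c\<in>I. \<Sum>b\<in>I.
        t (c, d) * (coev X (bvec ()) (a, b) * (T (bvec (b, c)) (b', c') * ev X (bvec (c', d)) ())))"
      by (subst sum.swap, rule sum.cong[OF refl], rule sum.cong[OF refl], rule sum.swap)
    also have "\<dots> = (\<Sum>d\<in>I. \<Sum>c\<in>I. \<Sum>b\<in>I. \<Sum>c'\<in>I.
        t (c, d) * (coev X (bvec ()) (a, b) * (T (bvec (b, c)) (b', c') * ev X (bvec (c', d)) ())))"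
      by (rule sum.cong[OF refl], subst sum.swap, rule sum.cong[OF refl], rule sum.swap)
    also have "\<dots> = (\<Sum>d\<in>I. \<Sum>c\<in>I. t (c, d) * T (bvec (c, d)) (a, b'))"
      using True by (simp add: crossing_kernel flip: sum_distrib_left)
    also have "\<dots> = T t s"
      unfolding s by (subst sum.swap) (rule T_sum[symmetric])
    finally show ?thesis .
  next
    \<comment> \<open>Outside the index set the left side vanishes because of its identity leg, and
      the right side because \<open>comul\<close> does.\<close>
    case False
    then have "T t s = 0"
      by (cases a, cases b') (auto simp: s T_def fcomult_eq comul_def)
    moreover have "(a, b') \<notin> ix XX"
      using False by simp
    then have "?lhs = 0"
      unfolding s by (rule otensor_id_left_outside)
    ultimately show ?thesis
      by simp
  qed
  then show "otensor XX XX id (ev X)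
      (case_prod (\<lambda>(a, b) (c, d). otensor (htensor X XX) X (otensor X XX id T) id
        (\<lambda>((a, (b, c)), d). otensor hunit XX (coev X) id (\<lambda>(u :: unit, p). t p) ((a, b), (c, d)))
        ((a, (b, c)), d))) (s, ()) = hadj XX XX T t s"
    unfolding hadj_T s2_def s1_def by simp
qed

end

theorem corollary6p29:
  fixes N :: nat and n :: "nat \<Rightarrow> nat" and \<rho> :: "nat \<Rightarrow> complex mat"
  assumes size: "\<And>\<alpha>. \<alpha> < N \<Longrightarrow> n \<alpha> \<ge> 1"
    and carrier: "\<And>\<alpha>. \<alpha> < N \<Longrightarrow> \<rho> \<alpha> \<in> carrier_mat (n \<alpha>) (n \<alpha>)"
    and pos: "\<And>\<alpha>. \<alpha> < N \<Longrightarrow> positive_mat (\<rho> \<alpha>)"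
    and inv: "\<And>\<alpha>. \<alpha> < N \<Longrightarrow> invertible_mat (\<rho> \<alpha>)"
    and norm: "(\<Sum>\<alpha><N. mat_trace (\<rho> \<alpha>)) = 1"
  shows "let X = gns_frobenius N n (density_functional N n \<rho>);
             T = (\<lambda>t. fcomult X (fmult X t))
         in (special X \<longleftrightarrow>
              (\<exists>d::real. d > 0 \<and> (\<forall>\<alpha><N. mat_trace (inv_mat (\<rho> \<alpha>)) = complex_of_real d)))
          \<and> (standard X \<longleftrightarrow>
              (\<forall>\<alpha><N. \<rho> \<alpha> = (of_nat (n \<alpha>) / of_nat (\<Sum>\<beta><N. (n \<beta>)\<^sup>2)) \<cdot>\<^sub>m 1\<^sub>m (n \<alpha>)))
          \<and> crossing_symmetric X T
          \<and> (\<forall>\<alpha><N. \<forall>\<beta><N. \<forall>x\<in>carrier_mat (n \<alpha>) (n \<alpha>). \<forall>y\<in>carrier_mat (n \<beta>) (n \<beta>).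
              T (tens (embed_block N n \<alpha> x) (embed_block N n \<beta> y)) =
                (if \<alpha> = \<beta>
                 then tmult N n (tens (embed_block N n \<alpha> (x * y)) (embed_block N n \<beta> (inv_mat (\<rho> \<beta>))))
                        (flip_elt N n \<alpha>)
                 else 0))"
proof -
  interpret multimatrix_state N n \<rho>
    using assms by unfold_locales
  have T: "T = (\<lambda>t. fcomult X (fmult X t))"
    by (simp add: fun_eq_iff T_def)
  show ?thesis
    unfolding Let_def
  proof (intro conjI allI impI ballI)
    show "special X \<longleftrightarrow> (\<exists>d::real. d > 0 \<and> (\<forall>\<alpha><N. mat_trace (r \<alpha>) = complex_of_real d))"
      by (simp add: special_def special_with_iff)
    show "crossing_symmetric X (\<lambda>t. fcomult X (fmult X t))"
      using crossing_symmetric_T by (simp only: T)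
  qed (rule standard_iff, rule fcomult_fmult_tens)
qed

end
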